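(* Let $\Theta=\{\theta_1,\dots,\theta_M\}$ be finite, and suppose that there is $\theta^*\in\Theta$ such that for each $\theta\in\Theta$ $$\mathbb{E}^\theta_1\Big[\log\tfrac{f_{\theta^*}(X_1)}{f_0(X_1)}\Big]=D(f_\theta\,\|\,f_0)-D(f_\theta\,\|\,f_{\theta^*})>0 .$$ Then, for any fixed $\mu>0$, $h\ge0$ and with the threshold $A=\log(M/\alpha)$, $\alpha\in(0,1)$, $$\mathsf{FAR}(\tau_{\mathrm{GD}})\le\mathsf{FAR}(\tau_{\mathrm{GC}})\le\alpha,\qquad \mathsf{PDC}(\tau_{\mathrm{GD}})=\mathsf{PDC}(\tau_{\mathrm W}(\theta^* )).$$ Also, if $\mu>0$ and $0\le h<\infty$, then for each $\theta_k$, $k=1,\dots,M$, $$\mathsf{WADD}^{\theta_k}(\tau_{\mathrm{GD}})\sim\mathsf{WADD}^{\theta_k}(\tau_{\mathrm{GC}})\sim\frac{|\log\alpha|}{D(f_{\theta_k}\,\|\,f_0)}(1+o(1))\quad\text{as }\alpha\to0.$$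
   Context: **Model.** $\{X_n\}_{n\ge1}$ are independent random variables; $X_n$ has density $f_0$ for $n<\gamma$ and density $f_\theta$ for $n\ge\gamma$, where $\gamma\ge1$ and $\theta\in\Theta$ are unknown and $f_\theta\ne f_0$ for all $\theta\in\Theta$. $\mathbb{P}^\theta_\gamma,\mathbb{E}^\theta_\gamma$ denote the corresponding probability and expectation; $\mathbb{P}_\infty,\mathbb{E}_\infty$ correspond to no change (all $X_n$ i.i.d. with density $f_0$). $D(p\|q)$ is the Kullback–Leibler divergence; $D(f_\theta\|f_0)=\mathbb{E}^\theta_1[\log\frac{f_\theta(X_1)}{f_0(X_1)}]$ and $D(f_0\|f_\theta)=-\mathbb{E}_\infty[\log\frac{f_\theta(X_1)}{f_0(X_1)}]$ are assumed finite and positive for every $\theta\in\Theta$. **Policies.** $S_n\in\{0,1\}$ indicates whether $X_n$ is used for decision making; $S_n$ is a function of $\mathcal{I}_{n-1}$, where $\mathcal{I}_n=\{X_1^{(S_1)},\dots,X_n^{(S_n)}\}$ and $X_k^{(S_k)}=X_k$ if $S_k=1$, while $X_k$ is absent if $S_k=0$. A policy $\Psi$ consists of the control maps producing $S_n$ and a stopping time $\tau$ with respect to $\{\mathcal{I}_n\}$; a policy is denoted by its stopping time. **Metrics.** $\mathsf{FAR}(\Psi)=1/\mathbb{E}_\infty[\tau]$; $\mathsf{PDC}(\Psi)=\limsup_{\gamma\to\infty}\mathbb{E}_\infty\big[\frac1\gamma\sum_{n=1}^{\gamma-1}S_n\big]$; $\mathsf{WADD}^\theta(\Psi)=\sup_{\gamma\ge1}\operatorname{ess\,sup}\mathbb{E}^\theta_\gamma[(\tau-\gamma)^+\mid\mathcal{I}_{\gamma-1}]$,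 where $x^+=\max\{0,x\}$. **GCuSum.** All samples are used ($S_n=1$ for all $n$), $G_n=\max_{1\le k\le n}\max_{\theta\in\Theta}\sum_{i=k}^n\log\frac{f_\theta(X_i)}{f_0(X_i)}$, and $\tau_{\mathrm{GC}}=\inf\{n\ge1:G_n\ge A\}$. **DECuSum for $\theta^*$.** Set $W_0(\theta^* )=0$. For $n\ge1$: if $W_{n-1}(\theta^* )\ge0$, then $S_n=1$ and $W_n(\theta^* )=\max\{-h,\;W_{n-1}(\theta^* )+\log\frac{f_{\theta^*}(X_n)}{f_0(X_n)}\}$; if $W_{n-1}(\theta^* )<0$, then $S_n=0$ and $W_n(\theta^* )=\min\{0,W_{n-1}(\theta^* )+\mu\}$. The sequence $S_n$ is generated by this recursion for all $n$. $\tau_{\mathrm W}(\theta^* )=\inf\{n\ge1:W_n(\theta^* )\ge A\}$. **GDECuSum.** The observation control $S_n$ is the one produced by the recursion for $W_n(\theta^* )$ above. With the convention $\frac{f_\theta(X_i^{(S_i)})}{f_0(X_i^{(S_i)})}=1$ if $S_i=0$, put $\bar G_n=\max_{1\le k\le n}\max_{\theta\in\Theta}\sum_{i=k}^n\log\frac{f_\theta(X_i^{(S_i)})}{f_0(X_i^{(S_i)})}$ and $\tau_{\mathrm{GD}}=\inf\{n\ge1:\bar G_n\ge A\}$. All algorithms use the same $\mu,h,A$. *)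

theory Defs
  imports "HOL-Probability.Probability" "HOL-Library.Landau_Symbols"
begin

section \<open>Densities and Kullback--Leibler divergence\<close>

text \<open>
  All densities are taken with respect to one sigma-finite reference measure \<open>\<nu>\<close> on an arbitrary
  sample space (for real-valued observations: \<^term>\<open>lborel\<close>).
\<close>

definition prob_density :: "'a measure \<Rightarrow> ('a \<Rightarrow> real) \<Rightarrow> bool" where
  "prob_density \<nu> p \<longleftrightarrow>
     p \<in> borel_measurable \<nu> \<and> (\<forall>x\<in>space \<nu>. 0 \<le> p x) \<and> (\<integral>\<^sup>+x. ennreal (p x) \<partial>\<nu>) = 1"

text \<open>
  \<open>KL \<nu> p q\<close> is $D(p \| q)$ with the natural logarithm; note that the library constant takes the
  two measures in the opposite order. As it is real-valued, finiteness is a separate predicate.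
\<close>

definition KL :: "'a measure \<Rightarrow> ('a \<Rightarrow> real) \<Rightarrow> ('a \<Rightarrow> real) \<Rightarrow> real" where
  "KL \<nu> p q = KL_divergence (exp 1) (density \<nu> (\<lambda>x. ennreal (q x))) (density \<nu> (\<lambda>x. ennreal (p x)))"

definition KL_finite :: "'a measure \<Rightarrow> ('a \<Rightarrow> real) \<Rightarrow> ('a \<Rightarrow> real) \<Rightarrow> bool" where
  "KL_finite \<nu> p q \<longleftrightarrow>
     absolutely_continuous (density \<nu> (\<lambda>x. ennreal (q x))) (density \<nu> (\<lambda>x. ennreal (p x))) \<and>
     integrable (density \<nu> (\<lambda>x. ennreal (p x)))
       (entropy_density (exp 1) (density \<nu> (\<lambda>x. ennreal (q x))) (density \<nu> (\<lambda>x. ennreal (p x))))"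


section \<open>The change-point model\<close>

text \<open>
  Canonical sample space: an outcome \<open>\<omega>\<close> is the sequence of observations and $X_n(\omega)$ is
  \<open>\<omega> n\<close>, for \<open>n \<ge> 1\<close>.
\<close>

definition P_inf :: "'a measure \<Rightarrow> ('a \<Rightarrow> real) \<Rightarrow> (nat \<Rightarrow> 'a) measure" where
  "P_inf \<nu> f0 = (\<Pi>\<^sub>M n\<in>{1..}. density \<nu> (\<lambda>x. ennreal (f0 x)))"

definition P_change :: "'a measure \<Rightarrow> ('a \<Rightarrow> real) \<Rightarrow> ('a \<Rightarrow> real) \<Rightarrow> nat \<Rightarrow> (nat \<Rightarrow> 'a) measure" where
  "P_change \<nu> f0 f1 \<gamma> =
     (\<Pi>\<^sub>M n\<in>{1..}. density \<nu> (\<lambda>x. ennreal (if n < \<gamma> then f0 x else f1 x)))"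


text \<open>The identity $E_1[\log (q/f_0)(X_1)] = D(p\|f_0) - D(p\|q)$ behind the drift condition.\<close>

lemma KL_diff_eq:
  assumes \<nu>: "sigma_finite_measure \<nu>"
    and d: "prob_density \<nu> p" "prob_density \<nu> f0" "prob_density \<nu> q"
    and fin: "KL_finite \<nu> p f0" "KL_finite \<nu> p q"
  shows "integrable (P_change \<nu> f0 p 1) (\<lambda>\<omega>. ln (q (\<omega> 1) / f0 (\<omega> 1)))"
    and "(\<integral>\<omega>. ln (q (\<omega> 1) / f0 (\<omega> 1)) \<partial>P_change \<nu> f0 p 1) = KL \<nu> p f0 - KL \<nu> p q"
proof -
  interpret sigma_finite_measure \<nu> by fact
  have [measurable]: "p \<in> borel_measurable \<nu>" "f0 \<in> borel_measurable \<nu>" "q \<in> borel_measurable \<nu>"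
    and nn: "\<And>x. x \<in> space \<nu> \<Longrightarrow> 0 \<le> p x" "\<And>x. x \<in> space \<nu> \<Longrightarrow> 0 \<le> f0 x" "\<And>x. x \<in> space \<nu> \<Longrightarrow> 0 \<le> q x"
    using d by (auto simp: prob_density_def)
  define D where "D = (\<lambda>r x. ln (p x / r x))"
  have key: "AE x in density \<nu> p. 0 < r x" 
     "AE x in density \<nu> p. entropy_density (exp 1) (density \<nu> r) (density \<nu> p) x = D r x"
    if "KL_finite \<nu> p r" "prob_density \<nu> r" for r
  proof -
    have [measurable]: "r \<in> borel_measurable \<nu>" and r0: "\<And>x. x \<in> space \<nu> \<Longrightarrow> 0 \<le> r x"
      using that by (auto simp: prob_density_def)
    have ac: "absolutely_continuous (density \<nu> r) (density \<nu> p)" using that by (simp add: KL_finite_def)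
    have "{x\<in>space \<nu>. \<not> 0 < r x} \<in> null_sets (density \<nu> r)"
      by (subst null_sets_density_iff) (auto intro!: AE_I2 simp: not_less ennreal_neg)
    then have "{x\<in>space \<nu>. \<not> 0 < r x} \<in> null_sets (density \<nu> p)"
      using ac by (auto simp: absolutely_continuous_def)
    then show pos: "AE x in density \<nu> p. 0 < r x" by (intro AE_I'[of _ _ ]) auto
    then have pos': "AE x in \<nu>. 0 < p x \<longrightarrow> 0 < r x" by (simp add: AE_density)
    interpret R: prob_space "density \<nu> r"
      using that by (intro prob_spaceI) (auto simp: prob_density_def emeasure_density cong: nn_integral_cong)
    have eq: "density (density \<nu> r) (\<lambda>x. ennreal (p x / r x)) = density \<nu> p"
    proof (subst density_density_eq)
      have "AE x in \<nu>. ennreal (r x) * ennreal (p x / r x) = ennreal (p x)"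
        using pos' AE_space
      proof eventually_elim
        case (elim x)
        then show ?case using nn(1)[of x] r0[of x]
          by (cases "p x = 0") (auto simp: ennreal_mult[symmetric])
      qed
      then show "density \<nu> (\<lambda>x. ennreal (r x) * ennreal (p x / r x)) = density \<nu> p"
        by (intro density_cong) auto
    qed auto
    have "AE x in density \<nu> r. ennreal (p x / r x) = RN_deriv (density \<nu> r) (density \<nu> p) x"
      by (rule R.RN_deriv_unique) (auto simp: eq)
    then have "AE x in density \<nu> p. ennreal (p x / r x) = RN_deriv (density \<nu> r) (density \<nu> p) x"
      using ac by (intro absolutely_continuous_AE[OF _ ac]) auto
    then show "AE x in density \<nu> p. entropy_density (exp 1) (density \<nu> r) (density \<nu> p) x = D r x"
      using AE_space
    proof eventually_elim
      case (elim x)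
      then have x: "x \<in> space \<nu>" by simp
      have "0 \<le> p x / r x" using nn(1)[OF x] r0[OF x] by simp
      then show ?case using elim(1)[symmetric]
        by (simp add: entropy_density_def D_def log_def)
    qed
  qed
  have "AE x in density \<nu> p. 0 < p x" by (simp add: AE_density)
  then have e: "AE x in density \<nu> p. entropy_density (exp 1) (density \<nu> f0) (density \<nu> p) x
      - entropy_density (exp 1) (density \<nu> q) (density \<nu> p) x = ln (q x / f0 x)"
    using key[OF fin(1) d(2)] key[OF fin(2) d(3)]
    by eventually_elim (simp add: D_def ln_div)
  have i: "integrable (density \<nu> p) (entropy_density (exp 1) (density \<nu> f0) (density \<nu> p))"
    "integrable (density \<nu> p) (entropy_density (exp 1) (density \<nu> q) (density \<nu> p))"
    using fin by (auto simp: KL_finite_def)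
  have m: "entropy_density (exp 1) (density \<nu> r) (density \<nu> p) \<in> borel_measurable \<nu>" for r
    using measurable_entropy_density[of _ "density \<nu> r"] by simp
  have I: "integrable (density \<nu> p) (\<lambda>x. ln (q x / f0 x))"
    by (rule integrable_cong_AE_imp[OF Bochner_Integration.integrable_diff[OF i] _ e]) auto
  have J: "(\<integral>x. ln (q x / f0 x) \<partial>density \<nu> p) = KL \<nu> p f0 - KL \<nu> p q"
    unfolding KL_def KL_divergence_def Bochner_Integration.integral_diff[OF i, symmetric]
    by (rule integral_cong_AE) (use e m in \<open>auto elim!: eventually_mono\<close>)
  have P: "P_change \<nu> f0 p 1 = (\<Pi>\<^sub>M n\<in>{1..}. density \<nu> p)"
    unfolding P_change_def by (intro PiM_cong) auto
  have ps: "prob_space (density \<nu> p)"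
    using d(1) by (intro prob_spaceI) (simp add: prob_density_def emeasure_density cong: nn_integral_cong)
  have M: "distr (P_change \<nu> f0 p 1) (density \<nu> p) (\<lambda>\<omega>. \<omega> 1) = density \<nu> p"
    unfolding P using ps by (intro distr_PiM_component) auto
  have X: "(\<lambda>\<omega>. \<omega> 1) \<in> P_change \<nu> f0 p 1 \<rightarrow>\<^sub>M density \<nu> p"
    unfolding P by (intro measurable_component_singleton) auto
  have L: "(\<lambda>x. ln (q x / f0 x)) \<in> borel_measurable (density \<nu> p)" by simp
  show "integrable (P_change \<nu> f0 p 1) (\<lambda>\<omega>. ln (q (\<omega> 1) / f0 (\<omega> 1)))"
    using integrable_distr_eq[OF X L] I unfolding M by blast
  show "(\<integral>\<omega>. ln (q (\<omega> 1) / f0 (\<omega> 1)) \<partial>P_change \<nu> f0 p 1) = KL \<nu> p f0 - KL \<nu> p q"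
    using integral_distr[OF X L] J unfolding M by argo
qed


section \<open>Policies, information and performance metrics\<close>

text \<open>\<open>control \<Psi> n \<omega>\<close> means that $S_n = 1$.\<close>

record 'a policy =
  control :: "nat \<Rightarrow> (nat \<Rightarrow> 'a) \<Rightarrow> bool"
  stop_time :: "(nat \<Rightarrow> 'a) \<Rightarrow> enat"

text \<open>$X_n^{(S_n)}$, where \<^term>\<open>None\<close> stands for an absent sample.\<close>

definition observe :: "(nat \<Rightarrow> (nat \<Rightarrow> 'a) \<Rightarrow> bool) \<Rightarrow> nat \<Rightarrow> (nat \<Rightarrow> 'a) \<Rightarrow> 'a option" where
  "observe S n \<omega> = (if S n \<omega> then Some (\<omega> n) else None)"

definition option_algebra :: "'a measure \<Rightarrow> 'a option measure" where
  "option_algebra N =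
     sigma (insert None (Some ` space N)) (insert {None} ((\<lambda>B. Some ` B) ` sets N))"

text \<open>The sigma-algebra generated by $\mathcal{I}_n = \{X_1^{(S_1)},\dots,X_n^{(S_n)}\}$.\<close>

definition info ::
  "'a measure \<Rightarrow> (nat \<Rightarrow> (nat \<Rightarrow> 'a) \<Rightarrow> bool) \<Rightarrow> nat \<Rightarrow> (nat \<Rightarrow> 'a) measure" where
  "info \<nu> S n =
     vimage_algebra (space (\<Pi>\<^sub>M k\<in>{1..}. \<nu>)) (\<lambda>\<omega>. \<lambda>k\<in>{1..n}. observe S k \<omega>)
       (\<Pi>\<^sub>M k\<in>{1..n}. option_algebra \<nu>)"

definition FAR :: "'a measure \<Rightarrow> ('a \<Rightarrow> real) \<Rightarrow> 'a policy \<Rightarrow> ennreal" where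
  "FAR \<nu> f0 \<Psi> = 1 / (\<integral>\<^sup>+\<omega>. ennreal_of_enat (stop_time \<Psi> \<omega>) \<partial>P_inf \<nu> f0)"

definition PDC :: "'a measure \<Rightarrow> ('a \<Rightarrow> real) \<Rightarrow> 'a policy \<Rightarrow> ennreal" where
  "PDC \<nu> f0 \<Psi> =
     limsup (\<lambda>\<gamma>. \<integral>\<^sup>+\<omega>. ennreal (1 / real \<gamma> * (\<Sum>n = 1..\<gamma> - 1. of_bool (control \<Psi> n \<omega>))) \<partial>P_inf \<nu> f0)"

text \<open>Subtraction on \<^typ>\<open>enat\<close> is truncated at 0, which is the positive part.\<close>

definition WADD :: "'a measure \<Rightarrow> ('a \<Rightarrow> real) \<Rightarrow> ('a \<Rightarrow> real) \<Rightarrow> 'a policy \<Rightarrow> ennreal" where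
  "WADD \<nu> f0 f1 \<Psi> =
     (SUP \<gamma>\<in>{1..}. esssup (P_change \<nu> f0 f1 \<gamma>)
        (nn_cond_exp (P_change \<nu> f0 f1 \<gamma>) (info \<nu> (control \<Psi>) (\<gamma> - 1))
           (\<lambda>\<omega>. ennreal_of_enat (stop_time \<Psi> \<omega> - enat \<gamma>))))"


section \<open>The algorithms\<close>

text \<open>\<open>first_passage G A\<close> is $\inf\{n \ge 1 : G_n \ge A\}$, with $\inf\emptyset = \infty$.\<close>

definition first_passage ::
  "(nat \<Rightarrow> (nat \<Rightarrow> 'a) \<Rightarrow> 'b::linorder) \<Rightarrow> 'b \<Rightarrow> (nat \<Rightarrow> 'a) \<Rightarrow> enat" where
  "first_passage G A \<omega> = Inf {enat n | n. 1 \<le> n \<and> A \<le> G n \<omega>}"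

text \<open>
  Likelihood ratio of an observed sample, equal to 1 if the sample is absent. For mutually
  absolutely continuous densities the ratio is positive almost surely under every measure of
  the model, so that the library values of \<open>x / 0\<close> and \<open>ln 0\<close> play no role.
\<close>

fun lratio :: "('a \<Rightarrow> real) \<Rightarrow> ('a \<Rightarrow> real) \<Rightarrow> 'a option \<Rightarrow> real" where
  "lratio f0 f1 None = 1"
| "lratio f0 f1 (Some x) = f1 x / f0 x"

text \<open>
  The generalized CuSum statistic computed from the samples selected by \<open>S\<close>: $\bar G_n$, or
  $G_n$ if all samples are selected.
\<close>

definition glr ::
  "('a \<Rightarrow> real) \<Rightarrow> ('p \<Rightarrow> 'a \<Rightarrow> real) \<Rightarrow> 'p set \<Rightarrow> (nat \<Rightarrow> (nat \<Rightarrow> 'a) \<Rightarrow> bool)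
     \<Rightarrow> nat \<Rightarrow> (nat \<Rightarrow> 'a) \<Rightarrow> real" where
  "glr f0 f \<Theta> S n \<omega> =
     (MAX k\<in>{1..n}. MAX \<theta>\<in>\<Theta>. \<Sum>i = k..n. ln (lratio f0 (f \<theta>) (observe S i \<omega>)))"

text \<open>
  $W_n$ for the post-change density \<open>f1\<close>. The truncation level \<open>h\<close> may be \<open>\<infinity>\<close> (no truncation);
  the statistic itself is always finite if \<open>h \<ge> 0\<close>.
\<close>

primrec decusum ::
  "('a \<Rightarrow> real) \<Rightarrow> ('a \<Rightarrow> real) \<Rightarrow> real \<Rightarrow> ereal \<Rightarrow> nat \<Rightarrow> (nat \<Rightarrow> 'a) \<Rightarrow> ereal" where
  "decusum f0 f1 \<mu> h 0 \<omega> = 0"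
| "decusum f0 f1 \<mu> h (Suc n) \<omega> =
     (if 0 \<le> decusum f0 f1 \<mu> h n \<omega>
      then max (- h) (decusum f0 f1 \<mu> h n \<omega> + ereal (ln (f1 (\<omega> (Suc n)) / f0 (\<omega> (Suc n)))))
      else min 0 (decusum f0 f1 \<mu> h n \<omega> + ereal \<mu>))"

definition decusum_control ::
  "('a \<Rightarrow> real) \<Rightarrow> ('a \<Rightarrow> real) \<Rightarrow> real \<Rightarrow> ereal \<Rightarrow> nat \<Rightarrow> (nat \<Rightarrow> 'a) \<Rightarrow> bool" where
  "decusum_control f0 f1 \<mu> h n \<omega> \<longleftrightarrow> 0 \<le> decusum f0 f1 \<mu> h (n - 1) \<omega>"

definition GCuSum :: "('a \<Rightarrow> real) \<Rightarrow> ('p \<Rightarrow> 'a \<Rightarrow> real) \<Rightarrow> 'p set \<Rightarrow> real \<Rightarrow> 'a policy" where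
  "GCuSum f0 f \<Theta> A =
     \<lparr>control = (\<lambda>n \<omega>. True),
      stop_time = first_passage (glr f0 f \<Theta> (\<lambda>n \<omega>. True)) A\<rparr>"

definition DECuSum ::
  "('a \<Rightarrow> real) \<Rightarrow> ('a \<Rightarrow> real) \<Rightarrow> real \<Rightarrow> ereal \<Rightarrow> real \<Rightarrow> 'a policy" where
  "DECuSum f0 f1 \<mu> h A =
     \<lparr>control = decusum_control f0 f1 \<mu> h,
      stop_time = first_passage (decusum f0 f1 \<mu> h) (ereal A)\<rparr>"

definition GDECuSum ::
  "('a \<Rightarrow> real) \<Rightarrow> ('p \<Rightarrow> 'a \<Rightarrow> real) \<Rightarrow> 'p set \<Rightarrow> 'p \<Rightarrow> real \<Rightarrow> ereal \<Rightarrow> real \<Rightarrow> 'a policy" where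
  "GDECuSum f0 f \<Theta> \<theta>s \<mu> h A =
     \<lparr>control = decusum_control f0 (f \<theta>s) \<mu> h,
      stop_time = first_passage (glr f0 f \<Theta> (decusum_control f0 (f \<theta>s) \<mu> h)) A\<rparr>"


section \<open>Measurability\<close>

text \<open>
  The conditional expectations in \<^const>\<open>WADD\<close> are taken with respect to genuine subalgebras
  (\<^const>\<open>nn_cond_exp\<close> would be 0 otherwise).
\<close>

lemma measurable_observe:
  assumes S: "Measurable.pred (\<Pi>\<^sub>M k\<in>{1..}. \<nu>) (S n)" and n: "1 \<le> n"
  shows "observe S n \<in> (\<Pi>\<^sub>M k\<in>{1..}. \<nu>) \<rightarrow>\<^sub>M option_algebra \<nu>"
proof -
  define M where "M = (\<Pi>\<^sub>M k\<in>{1::nat..}. \<nu>)"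
  have X: "(\<lambda>\<omega>. \<omega> n) \<in> M \<rightarrow>\<^sub>M \<nu>"
    unfolding M_def using n by (intro measurable_component_singleton) auto
  have S': "{\<omega>\<in>space M. S n \<omega>} \<in> sets M"
    using S unfolding M_def pred_def .
  have "observe S n \<in> M \<rightarrow>\<^sub>M option_algebra \<nu>"
    unfolding option_algebra_def
  proof (rule measurable_sigma_sets[OF sets_measure_of])
    show "insert {None} ((`) Some ` sets \<nu>) \<subseteq> Pow (insert None (Some ` space \<nu>))"
      using sets.sets_into_space by fastforce
    then show "insert {None} ((`) Some ` sets \<nu>) \<subseteq> Pow (insert None (Some ` space \<nu>))" .
    show "observe S n \<in> space M \<rightarrow> insert None (Some ` space \<nu>)"
      using measurable_space[OF X] by (auto simp: observe_def)
    fix y assume "y \<in> insert {None} ((`) Some ` sets \<nu>)"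
    then consider "y = {None}" | B where "B \<in> sets \<nu>" "y = Some ` B" by auto
    then show "observe S n -` y \<inter> space M \<in> sets M"
    proof cases
      case 1
      have "observe S n -` y \<inter> space M = space M - {\<omega>\<in>space M. S n \<omega>}"
        unfolding 1 by (auto simp: observe_def)
      then show ?thesis using S' by (simp only: sets.compl_sets)
    next
      case (2 B)
      have "observe S n -` y \<inter> space M = {\<omega>\<in>space M. S n \<omega>} \<inter> ((\<lambda>\<omega>. \<omega> n) -` B \<inter> space M)"
        unfolding 2 by (auto simp: observe_def split: if_splits)
      then show ?thesis using S' measurable_sets[OF X 2(1)] by (simp only: sets.Int)
    qed
  qed
  then show ?thesis unfolding M_def .
qed

lemma subalgebra_info:
  assumes "\<And>k. 1 \<le> k \<Longrightarrow> Measurable.pred (\<Pi>\<^sub>M k\<in>{1..}. \<nu>) (S k)"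
  shows "subalgebra (P_change \<nu> f0 f1 \<gamma>) (info \<nu> S n)"
proof -
  have s: "sets (P_change \<nu> f0 f1 \<gamma>) = sets (\<Pi>\<^sub>M k\<in>{1..}. \<nu>)"
    unfolding P_change_def by (intro sets_PiM_cong) auto
  have "(\<lambda>\<omega>. \<lambda>k\<in>{1..n}. observe S k \<omega>) \<in> (\<Pi>\<^sub>M k\<in>{1..}. \<nu>) \<rightarrow>\<^sub>M (\<Pi>\<^sub>M k\<in>{1..n}. option_algebra \<nu>)"
    using assms by (intro measurable_restrict measurable_observe) auto
  from measurable_sets[OF this] show ?thesis
    unfolding subalgebra_def info_def s sets_eq_imp_space_eq[OF s] sets_vimage_algebra
    by (intro conjI sets.sigma_sets_subset) auto
qed

lemma measurable_decusum_control:
  assumes [measurable]: "f0 \<in> borel_measurable \<nu>" "f1 \<in> borel_measurable \<nu>"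
  shows "Measurable.pred (\<Pi>\<^sub>M k\<in>{1..}. \<nu>) (decusum_control f0 f1 \<mu> h n)"
proof -
  have [measurable]: "decusum f0 f1 \<mu> h n \<in> borel_measurable (\<Pi>\<^sub>M k\<in>{1..}. \<nu>)" for n
  proof (induction n)
    case (Suc n)
    note [measurable] = Suc
    have [measurable]: "(\<lambda>\<omega>. \<omega> (Suc n)) \<in> (\<Pi>\<^sub>M k\<in>{1..}. \<nu>) \<rightarrow>\<^sub>M \<nu>"
      by (intro measurable_component_singleton) auto
    show ?case unfolding decusum.simps by measurable
  qed simp
  show ?thesis unfolding decusum_control_def by measurable
qed

end

theory Submission
  imports Defs "HOL-Real_Asymp.Real_Asymp"
begin

text \<open>
  Each \<open>G\<^sub>n\<close> is the maximum over \<open>\<theta>\<close> of CuSum recursions $V \mapsto V^+ + \log(f_\theta/f_0)$, in which a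
  skipped sample only replaces \<open>V\<close> by $V^+$; since the next step uses $V^+$ anyway, skipping postpones
  the crossing in law under any i.i.d. distribution. This gives the comparison of the two procedures
  both under no change and for a change at time 1.

  The other estimates are one-step drift inequalities for a potential, summed up to the stopping time.
  Under $f_0$ the Shiryaev--Roberts sum $R_n = \sum_{\theta,k}\prod_{i=k}^n f_\theta/f_0$ grows by at most \<open>M\<close> per
  step and exceeds $e^A$ when GCuSum stops. Under $f_\theta$ Jensen's inequality bounds the drift of
  $\log(c + R_n)$ by $D(f_\theta\|f_0) + M/c$, which yields the lower bound on the delay without a law of large
  numbers. For the upper bound, $(A + c - V_n^+)/m$, with \<open>m\<close> the mean of the log-likelihood ratio truncated
  at \<open>c\<close>, counts the observations still to be made; the skipped samples cost only a bounded amount, because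
  the statistic $W_n(\theta^*)$ has positive drift after the change and restarts at 0 after each undershoot.
\<close>

text \<open>The simplifier would otherwise turn the index set \<open>{1..}\<close> of the sample space into \<open>{Suc 0..}\<close>.\<close>

declare One_nat_def[simp del]

text \<open>The comparison of the two procedures cannot hold path by path: a skipped sample may have
  had a negative log-likelihood ratio, and then the skipping procedure can cross first. Hence the
  comparison in law, which exchanges actual steps for observed ones one at a time. It bounds the
  delay of the skipping procedure only from below, so the upper bound needs a separate argument that
  pays for the skips. That argument follows only the statistic of the true parameter, because the
  maximum over \<open>\<Theta>\<close> crosses no later; \<open>\<theta>s\<close> enters it through
  the skips alone. The drift inequalities are stated for a fixed past in which only the next sample
  is redrawn. They are summed in \<open>ennreal\<close>, where expected stopping times need not be
  known to be finite beforehand; without subtraction, telescoping adds what is lost to what remains.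
  Conditioning on the past becomes restricting integrals to a past event, which makes the delay
  bound uniform in the change time and the past.\<close>

subsection \<open>The CuSum recursion\<close>

text \<open>Redrawing one coordinate does not change the law of an independent sequence. This stands
  in for conditioning on the past: whatever ignores coordinate \<open>k\<close> is a constant for
  the inner integral.\<close>

lemma nn_integral_PiM_resample:
  assumes N: "\<And>i. i \<in> I \<Longrightarrow> prob_space (N i)" and k: "k \<in> I"
    and [measurable]: "H \<in> borel_measurable (PiM I N)"
  shows "(\<integral>\<^sup>+\<xi>. H \<xi> \<partial>PiM I N) = (\<integral>\<^sup>+\<xi>. \<integral>\<^sup>+x. H (\<xi>(k := x)) \<partial>N k \<partial>PiM I N)"
proof -
  define J where "J = I - {k}"
  have I: "I = insert k J" using k by (auto simp: J_def)
  interpret K: prob_space "N k" using N k by auto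
  interpret J: prob_space "PiM J N" using N by (intro prob_space_PiM) (auto simp: J_def)
  interpret pair_prob_space "N k" "PiM J N" ..
  have [measurable]: "(\<lambda>(x, X). X(k := x)) \<in> N k \<Otimes>\<^sub>M PiM J N \<rightarrow>\<^sub>M PiM I N"
    using measurable_compose[OF measurable_pair_swap' measurable_add_dim[of k J N]]
    unfolding I by (simp add: case_prod_beta')
  have *: "PiM I N = distr (N k \<Otimes>\<^sub>M PiM J N) (PiM I N) (\<lambda>(x, X). X(k := x))"
    unfolding I using N k by (intro distr_pair_PiM_eq_PiM[symmetric]) (auto simp: J_def)
  have [measurable]: "(\<lambda>\<xi>. \<integral>\<^sup>+x. H (\<xi>(k := x)) \<partial>N k) \<in> borel_measurable (PiM I N)"
  proof -
    have [measurable]: "(\<lambda>(\<xi>, x). \<xi>(k := x)) \<in> PiM I N \<Otimes>\<^sub>M N k \<rightarrow>\<^sub>M PiM I N"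
      using k by (subst (2) insert_absorb[OF k, symmetric]) (rule measurable_add_dim)
    show ?thesis by measurable
  qed
  have D: "(\<integral>\<^sup>+\<xi>. G \<xi> \<partial>PiM I N) = (\<integral>\<^sup>+x. \<integral>\<^sup>+X. G (X(k := x)) \<partial>PiM J N \<partial>N k)"
    if [measurable]: "G \<in> borel_measurable (PiM I N)" for G
    by (subst *, subst nn_integral_distr) (simp_all add: J.nn_integral_fst[symmetric] case_prod_beta')
  have "(\<integral>\<^sup>+\<xi>. H \<xi> \<partial>PiM I N) = (\<integral>\<^sup>+X. \<integral>\<^sup>+x. H (X(k := x)) \<partial>N k \<partial>PiM J N)"
    unfolding D[OF assms(3)] by (intro Fubini'[symmetric]) measurable
  \<comment> \<open>The extra variable \<open>y\<close> is overwritten at once, so integrating over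
    it only multiplies by the total mass 1.\<close>
  also have "\<dots> = (\<integral>\<^sup>+y. \<integral>\<^sup>+X. \<integral>\<^sup>+x. H ((X(k := y))(k := x)) \<partial>N k \<partial>PiM J N \<partial>N k)"
    by (simp add: K.emeasure_space_1)
  also have "\<dots> = (\<integral>\<^sup>+\<xi>. \<integral>\<^sup>+x. H (\<xi>(k := x)) \<partial>N k \<partial>PiM I N)"
    by (rule D[symmetric]) measurable
  finally show ?thesis .
qed

text \<open>Tail-sum formula: expected stopping times become sums of probabilities of not having
  stopped, also when they are infinite.\<close>

lemma ennreal_of_enat_eq_suminf:
  "ennreal_of_enat t = (\<Sum>n. of_bool (enat n < t))"
proof (cases t)
  case (enat m)
  have "(\<lambda>n. of_bool (n < m) :: ennreal) sums (\<Sum>n<m. of_bool (n < m))"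
    by (rule sums_finite) auto
  then show ?thesis using enat by (simp add: sums_iff)
next
  case infinity
  have "(\<lambda>n. 1 :: ennreal) sums top"
    by (simp add: sums_def of_nat_tendsto_top_ennreal)
  then show ?thesis using infinity by (simp add: sums_iff)
qed

text \<open>The cut at 0 comes before the increment, so for \<open>n\<close> \<ge> 1 the value is a
  maximum over nonempty windows ending at \<open>n\<close> and may be negative, as in
  \<open>glr\<close>.\<close>

primrec cusum :: "(nat \<Rightarrow> (nat \<Rightarrow> 'a) \<Rightarrow> bool) \<Rightarrow> ('a \<Rightarrow> real) \<Rightarrow> nat \<Rightarrow> (nat \<Rightarrow> 'a) \<Rightarrow> real" where
  "cusum S l 0 \<xi> = 0"
| "cusum S l (Suc n) \<xi> = max 0 (cusum S l n \<xi>) + (if S (Suc n) \<xi> then l (\<xi> (Suc n)) else 0)"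

text \<open>Positivity of \<open>a\<close> is for \<open>n = 0\<close>, where the statistic is 0 and
  there is no window.\<close>

lemma cusum_ge_iff:
  assumes "0 < a"
  shows "a \<le> cusum S l n \<xi> \<longleftrightarrow> (\<exists>k\<in>{1..n}. a \<le> (\<Sum>i = k..n. if S i \<xi> then l (\<xi> i) else 0))"
proof -
  \<comment> \<open>The level varies in the induction: once the last increment \<open>?d\<close> is
    taken off, the level to be reached is \<open>t - ?d\<close>.\<close>
  have "t \<le> cusum S l (Suc n) \<xi> \<longleftrightarrow> (\<exists>k\<in>{1..Suc n}. t \<le> (\<Sum>i = k..Suc n. if S i \<xi> then l (\<xi> i) else 0))" for t n
  proof (induction n arbitrary: t)
    case (Suc n)
    let ?d = "if S (Suc (Suc n)) \<xi> then l (\<xi> (Suc (Suc n))) else 0"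
    have "t \<le> cusum S l (Suc (Suc n)) \<xi> \<longleftrightarrow> t \<le> ?d \<or> t - ?d \<le> cusum S l (Suc n) \<xi>"
      by (subst cusum.simps) (auto simp: max_def)
    also have "\<dots> \<longleftrightarrow> t \<le> ?d \<or> (\<exists>k\<in>{1..Suc n}. t \<le> (\<Sum>i = k..Suc n. if S i \<xi> then l (\<xi> i) else 0) + ?d)"
      unfolding Suc.IH by (simp add: diff_le_eq)
    also have "\<dots> \<longleftrightarrow> (\<exists>k\<in>insert (Suc (Suc n)) {1..Suc n}. t \<le> (\<Sum>i = k..Suc (Suc n). if S i \<xi> then l (\<xi> i) else 0))"
      by (auto simp: sum.nat_ivl_Suc')
    finally show ?case by (simp add: atLeastAtMostSuc_conv)
  qed auto
  then show ?thesis using assms by (cases n) (simp_all only: cusum.simps, auto)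
qed

lemma cusum_resample:
  assumes S: "\<And>i m \<xi> x. i \<le> m \<Longrightarrow> S i (\<xi>(m := x)) = S i \<xi>" and "n < m"
  shows "cusum S l n (\<xi>(m := x)) = cusum S l n \<xi>"
  using \<open>n < m\<close> by (induction n) (auto simp: S)

lemma measurable_sample:
  assumes "\<And>i. sets (N i) = sets \<nu>"
  shows "(\<lambda>\<xi>. \<xi> (Suc n)) \<in> PiM {1..} N \<rightarrow>\<^sub>M \<nu>"
proof -
  have "(\<lambda>\<xi>. \<xi> (Suc n)) \<in> PiM {1..} N \<rightarrow>\<^sub>M N (Suc n)"
    by (intro measurable_component_singleton) auto
  then show ?thesis using measurable_cong_sets[OF refl assms] by blast
qed

lemma measurable_cusum:
  assumes N: "\<And>i. sets (N i) = sets \<nu>" and [measurable]: "l \<in> borel_measurable \<nu>"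
    and S: "\<And>n. Measurable.pred (PiM {1..} N) (S n)"
  shows "cusum S l n \<in> borel_measurable (PiM {1..} N)"
proof (induction n)
  case (Suc n)
  note [measurable] = Suc S measurable_sample[OF N]
  show ?case unfolding cusum.simps by measurable
qed simp

text \<open>For a positive threshold this is the event that the procedure has not stopped by time
  \<open>n\<close>. The estimates use it in place of the stopping time, since it is decided one step
  at a time.\<close>

definition below :: "(nat \<Rightarrow> (nat \<Rightarrow> 'a) \<Rightarrow> bool) \<Rightarrow> ('p \<Rightarrow> 'a \<Rightarrow> real) \<Rightarrow> 'p set \<Rightarrow> real \<Rightarrow> nat \<Rightarrow> (nat \<Rightarrow> 'a) \<Rightarrow> bool" where
  "below S l \<Theta> a n \<xi> \<longleftrightarrow> (\<forall>m\<in>{1..n}. \<forall>\<theta>\<in>\<Theta>. cusum S (l \<theta>) m \<xi> < a)"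

lemma below_0[simp]: "below S l \<Theta> a 0 \<xi>" by (simp add: below_def)

lemma below_Suc:
  "below S l \<Theta> a (Suc n) \<xi> \<longleftrightarrow> below S l \<Theta> a n \<xi> \<and> (\<forall>\<theta>\<in>\<Theta>. cusum S (l \<theta>) (Suc n) \<xi> < a)"
  by (auto simp: below_def atLeastAtMostSuc_conv simp del: cusum.simps)

lemma below_resample:
  assumes S: "\<And>i m \<xi> x. i \<le> m \<Longrightarrow> S i (\<xi>(m := x)) = S i \<xi>" and "n < m"
  shows "below S l \<Theta> a n (\<xi>(m := x)) = below S l \<Theta> a n \<xi>"
  using \<open>n < m\<close> by (auto simp: below_def cusum_resample[OF S])

lemma measurable_below:
  assumes "\<And>i. sets (N i) = sets \<nu>" and "\<And>\<theta>. \<theta> \<in> \<Theta> \<Longrightarrow> l \<theta> \<in> borel_measurable \<nu>"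
    and "\<And>n. Measurable.pred (PiM {1..} N) (S n)" and "finite \<Theta>"
  shows "Measurable.pred (PiM {1..} N) (below S l \<Theta> a n)"
  unfolding below_def using assms
  by (intro pred_intros_finite borel_measurable_pred_less measurable_cusum[where \<nu>=\<nu>]) auto

lemma enat_less_Inf_iff:
  "enat n < Inf {enat m | m. 1 \<le> m \<and> Q m} \<longleftrightarrow> (\<forall>m\<in>{1..n}. \<not> Q m)"
proof
  assume *: "enat n < Inf {enat m | m. 1 \<le> m \<and> Q m}"
  show "\<forall>m\<in>{1..n}. \<not> Q m"
  proof (intro ballI notI)
    fix m assume "m \<in> {1..n}" "Q m"
    then have "Inf {enat m | m. 1 \<le> m \<and> Q m} \<le> enat m" by (intro Inf_lower) auto
    with * \<open>m \<in> {1..n}\<close> show False by (auto dest: order_less_le_trans)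
  qed
next
  assume *: "\<forall>m\<in>{1..n}. \<not> Q m"
  have "eSuc (enat n) \<le> Inf {enat m | m. 1 \<le> m \<and> Q m}"
    using * by (intro Inf_greatest) (auto simp: eSuc_enat not_less_eq_eq)
  then show "enat n < Inf {enat m | m. 1 \<le> m \<and> Q m}" by (simp add: Suc_ile_eq eSuc_enat)
qed

lemma less_first_passage_glr_iff:
  assumes "finite \<Theta>" "\<Theta> \<noteq> {}" "0 < a"
  shows "enat n < first_passage (glr f0 f \<Theta> S) a \<xi>
     \<longleftrightarrow> below S (\<lambda>\<theta> x. ln (f \<theta> x / f0 x)) \<Theta> a n \<xi>"
proof -
  have l: "ln (lratio f0 (f \<theta>) (observe S i \<xi>)) = (if S i \<xi> then ln (f \<theta> (\<xi> i) / f0 (\<xi> i)) else 0)" for \<theta> i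
    by (simp add: observe_def)
  have "a \<le> glr f0 f \<Theta> S m \<xi> \<longleftrightarrow> (\<exists>\<theta>\<in>\<Theta>. a \<le> cusum S (\<lambda>x. ln (f \<theta> x / f0 x)) m \<xi>)" if "1 \<le> m" for m
  proof -
    have "a \<le> glr f0 f \<Theta> S m \<xi> \<longleftrightarrow>
        (\<exists>k\<in>{1..m}. \<exists>\<theta>\<in>\<Theta>. a \<le> (\<Sum>i = k..m. if S i \<xi> then ln (f \<theta> (\<xi> i) / f0 (\<xi> i)) else 0))"
      unfolding glr_def l using assms that by (simp add: Max_ge_iff)
    then show ?thesis unfolding cusum_ge_iff[OF \<open>0 < a\<close>] by blast
  qed
  then have "m \<in> {1..n} \<Longrightarrow> \<not> a \<le> glr f0 f \<Theta> S m \<xi> \<longleftrightarrow> (\<forall>\<theta>\<in>\<Theta>. cusum S (\<lambda>x. ln (f \<theta> x / f0 x)) m \<xi> < a)" for m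
    by (simp add: not_le)
  then show ?thesis
    unfolding first_passage_def below_def enat_less_Inf_iff by blast
qed

text \<open>\<open>N\<close> may depend on time, so that one setting covers no change and a change
  at any time. \<open>S_past\<close> is predictability without a filtration: the decision on sample
  \<open>i\<close> is insensitive to overwriting that sample or a later one.\<close>

locale observations =
  fixes \<nu> :: "'a measure" and N :: "nat \<Rightarrow> 'a measure" and S :: "nat \<Rightarrow> (nat \<Rightarrow> 'a) \<Rightarrow> bool"
    and l :: "'p \<Rightarrow> 'a \<Rightarrow> real" and \<Theta> :: "'p set"
  assumes prob_N: "\<And>i. prob_space (N i)" and sets_N[measurable_cong]: "\<And>i. sets (N i) = sets \<nu>"
    and S_past: "\<And>i m \<xi> x. i \<le> m \<Longrightarrow> S i (\<xi>(m := x)) = S i \<xi>"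
    and S_measurable[measurable]: "\<And>n. Measurable.pred (PiM {1..} N) (S n)"
    and l_measurable[measurable]: "\<And>\<theta>. \<theta> \<in> \<Theta> \<Longrightarrow> l \<theta> \<in> borel_measurable \<nu>"
    and finite_\<Theta>: "finite \<Theta>"
begin

abbreviation "P \<equiv> PiM {1..} N"

sublocale P: prob_space P
  by (intro prob_space_PiM prob_N)

lemma measurable_stat[measurable]:
  "\<theta> \<in> \<Theta> \<Longrightarrow> cusum S (l \<theta>) n \<in> borel_measurable P"
  by (rule measurable_cusum[OF sets_N _ S_measurable]) simp

lemma measurable_below'[measurable]: "Measurable.pred P (below S l \<Theta> a n)"
  by (rule measurable_below[OF sets_N _ S_measurable finite_\<Theta>]) simp

lemma resample:
  "H \<in> borel_measurable P \<Longrightarrow>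
     (\<integral>\<^sup>+\<xi>. H \<xi> \<partial>P) = (\<integral>\<^sup>+\<xi>. \<integral>\<^sup>+x. H (\<xi>(Suc n := x)) \<partial>N (Suc n) \<partial>P)"
  by (rule nn_integral_PiM_resample[OF prob_N]) auto

lemma cusum_Suc_resample:
  "cusum S g (Suc n) (\<xi>(Suc n := x)) = max 0 (cusum S g n \<xi>) + (if S (Suc n) \<xi> then g x else 0)"
  by (simp add: cusum_resample[OF S_past] S_past)

lemma below_past: "n < m \<Longrightarrow> below S l \<Theta> a n (\<xi>(m := x)) = below S l \<Theta> a n \<xi>"
  by (rule below_resample[OF S_past])

lemma below_Suc_resample:
  "below S l \<Theta> a (Suc n) (\<xi>(Suc n := x)) \<longleftrightarrow> below S l \<Theta> a n \<xi> \<and>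
     (\<forall>\<theta>\<in>\<Theta>. max 0 (cusum S (l \<theta>) n \<xi>) + (if S (Suc n) \<xi> then l \<theta> x else 0) < a)"
  by (simp only: below_Suc below_past lessI cusum_Suc_resample)

lemma below_imp_less:
  assumes "below S l \<Theta> a k \<xi>" "0 < a" "\<theta> \<in> \<Theta>"
  shows "max 0 (cusum S (l \<theta>) k \<xi>) < a"
proof (cases k)
  case (Suc m)
  then have "k \<in> {1..k}" by simp
  then show ?thesis using assms unfolding below_def by simp
qed (use assms in simp)

text \<open>Optional stopping: with \<tau> the crossing time, the potential is at least L at \<tau>
  and has mean at most \<psi> + \<kappa> E[\<tau>] there.\<close>

lemma stopping_lower_bound:
  fixes \<Psi> :: "nat \<Rightarrow> (nat \<Rightarrow> 'a) \<Rightarrow> ennreal"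
  assumes [measurable]: "\<And>n. \<Psi> n \<in> borel_measurable P"
    and drift: "\<And>n \<xi>. \<xi> \<in> space P \<Longrightarrow> (\<integral>\<^sup>+x. \<Psi> (Suc n) (\<xi>(Suc n := x)) \<partial>N (Suc n)) \<le> \<Psi> n \<xi> + \<kappa>"
    and level: "\<And>n \<xi>. \<not> below S l \<Theta> a (Suc n) \<xi> \<Longrightarrow> below S l \<Theta> a n \<xi> \<Longrightarrow> L \<le> \<Psi> (Suc n) \<xi>"
    and init: "\<And>\<xi>. \<Psi> 0 \<xi> \<le> \<psi>" and \<kappa>: "0 < \<kappa>" and L: "L \<noteq> \<top>"
  shows "L \<le> \<psi> + \<kappa> * (\<Sum>n. \<integral>\<^sup>+\<xi>. of_bool (below S l \<Theta> a n \<xi>) \<partial>P)"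
proof -
  \<comment> \<open>With \<tau> the crossing time, \<open>b n\<close> is P(\<tau> > n),
    \<open>c n\<close> is P(\<tau> = n + 1), and \<open>e n\<close> is the mean of the potential at
    time n on the event \<tau> > n.\<close>
  define b c e where "b n = (\<integral>\<^sup>+\<xi>. of_bool (below S l \<Theta> a n \<xi>) \<partial>P)"
    and "c n = (\<integral>\<^sup>+\<xi>. of_bool (below S l \<Theta> a n \<xi> \<and> \<not> below S l \<Theta> a (Suc n) \<xi>) \<partial>P)"
    and "e n = (\<integral>\<^sup>+\<xi>. of_bool (below S l \<Theta> a n \<xi>) * \<Psi> n \<xi> \<partial>P)" for n
  have step: "e (Suc n) + L * c n \<le> e n + \<kappa> * b n" for n
  proof -
    have "e (Suc n) + L * c n = (\<integral>\<^sup>+\<xi>. of_bool (below S l \<Theta> a (Suc n) \<xi>) * \<Psi> (Suc n) \<xi>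
        + L * of_bool (below S l \<Theta> a n \<xi> \<and> \<not> below S l \<Theta> a (Suc n) \<xi>) \<partial>P)"
      unfolding e_def c_def by (simp add: nn_integral_add nn_integral_cmult)
    also have "\<dots> \<le> (\<integral>\<^sup>+\<xi>. of_bool (below S l \<Theta> a n \<xi>) * \<Psi> (Suc n) \<xi> \<partial>P)"
      using level by (intro nn_integral_mono) (auto simp: of_bool_def below_Suc simp del: cusum.simps)
    also have "\<dots> = (\<integral>\<^sup>+\<xi>. \<integral>\<^sup>+x. of_bool (below S l \<Theta> a n \<xi>) * \<Psi> (Suc n) (\<xi>(Suc n := x)) \<partial>N (Suc n) \<partial>P)"
      by (subst resample[where n=n]) (simp_all add: below_past)
    also have "\<dots> \<le> (\<integral>\<^sup>+\<xi>. of_bool (below S l \<Theta> a n \<xi>) * (\<Psi> n \<xi> + \<kappa>) \<partial>P)"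
      using drift by (intro nn_integral_mono) (auto simp: of_bool_def)
    also have "\<dots> = e n + \<kappa> * b n"
      unfolding e_def b_def by (simp add: distrib_left nn_integral_add nn_integral_multc mult.commute[of \<kappa>])
    finally show ?thesis .
  qed
  have bc: "b n = b (Suc n) + c n" for n
  proof -
    have "b n = (\<integral>\<^sup>+\<xi>. of_bool (below S l \<Theta> a (Suc n) \<xi>)
        + of_bool (below S l \<Theta> a n \<xi> \<and> \<not> below S l \<Theta> a (Suc n) \<xi>) \<partial>P)"
      unfolding b_def by (intro nn_integral_cong) (auto simp: below_Suc simp del: cusum.simps)
    then show ?thesis unfolding b_def c_def by (simp add: nn_integral_add)
  qed
  have e0: "e 0 \<le> \<psi>"
  proof -
    have "e 0 \<le> (\<integral>\<^sup>+\<xi>. \<psi> \<partial>P)"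
      unfolding e_def using init by (intro nn_integral_mono) simp
    then show ?thesis by (simp add: P.emeasure_space_1)
  qed
  have sum_le: "e n + L * (\<Sum>i<n. c i) \<le> \<psi> + \<kappa> * (\<Sum>i<n. b i)" for n
  proof (induction n)
    case (Suc n)
    have "e (Suc n) + L * (\<Sum>i<Suc n. c i) = (e (Suc n) + L * c n) + L * (\<Sum>i<n. c i)"
      by (simp add: distrib_left ac_simps)
    also have "\<dots> \<le> (e n + \<kappa> * b n) + L * (\<Sum>i<n. c i)"
      by (intro add_mono step order_refl)
    also have "\<dots> = (e n + L * (\<Sum>i<n. c i)) + \<kappa> * b n" by (simp add: ac_simps)
    also have "\<dots> \<le> (\<psi> + \<kappa> * (\<Sum>i<n. b i)) + \<kappa> * b n"
      by (intro add_mono Suc.IH order_refl)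
    finally show ?case by (simp add: distrib_left ac_simps)
  qed (simp add: e0)
  have one: "(\<Sum>i<n. c i) + b n = 1" for n
  proof (induction n)
    case 0
    then show ?case by (simp add: b_def P.emeasure_space_1)
  next
    case (Suc n)
    then show ?case by (simp add: bc[of n] ac_simps)
  qed
  have *: "L \<le> \<psi> + \<kappa> * (\<Sum>i. b i) + L * b n" for n
  proof -
    have "L = L * (\<Sum>i<n. c i) + L * b n" by (simp flip: distrib_left add: one)
    also have "\<dots> \<le> (\<psi> + \<kappa> * (\<Sum>i<n. b i)) + L * b n"
      by (intro add_mono order_refl order_trans[OF add_increasing[OF zero_le order_refl] sum_le])
    also have "\<dots> \<le> (\<psi> + \<kappa> * (\<Sum>i. b i)) + L * b n"
      by (intro add_mono mult_left_mono sum_le_suminf order_refl) auto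
    finally show ?thesis .
  qed
  \<comment> \<open>If the expected time is infinite, \<kappa> > 0 makes the bound trivial.
    Otherwise P(\<tau> > n) tends to 0 and, \<open>L\<close> being finite, so does the part of
    \<open>L\<close> not yet collected by time n.\<close>
  show ?thesis
  proof (cases "(\<Sum>i. b i) = \<top>")
    case True
    then show ?thesis using \<kappa> by (auto simp: b_def[symmetric] ennreal_mult_top)
  next
    case False
    have b: "b n = ennreal (enn2real (b n))" for n
      using one[of n] ennreal_add_eq_top[of "\<Sum>i<n. c i" "b n"] by (auto simp: ennreal_enn2real_if)
    have "summable (\<lambda>n. enn2real (b n))"
      using False by (intro summable_suminf_not_top) (simp_all add: b[symmetric])
    then have "(\<lambda>n. ennreal (enn2real (b n))) \<longlonglongrightarrow> ennreal 0"
      by (intro tendsto_ennrealI summable_LIMSEQ_zero)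
    then have "b \<longlonglongrightarrow> 0" by (simp add: b[symmetric])
    then have "(\<lambda>n. \<psi> + \<kappa> * (\<Sum>i. b i) + L * b n) \<longlonglongrightarrow> \<psi> + \<kappa> * (\<Sum>i. b i) + L * 0"
      using L by (intro tendsto_intros) auto
    from LIMSEQ_le_const[OF this] show ?thesis using * by (simp add: b_def[symmetric])
  qed
qed

end

subsection \<open>Skipping samples postpones stopping\<close>

text \<open>Backward recursion for the probability that fully observed statistics started at the
  vector \<open>v\<close> stay below \<open>a\<close> for \<open>n\<close> further samples. They
  form one vector because the same sample moves them all; restricting it to \<open>\<Theta>\<close>
  makes it a point of the product space, which measurability requires.\<close>

primrec survival ::
  "'a measure \<Rightarrow> ('p \<Rightarrow> 'a \<Rightarrow> real) \<Rightarrow> 'p set \<Rightarrow> real \<Rightarrow> nat \<Rightarrow> ('p \<Rightarrow> real) \<Rightarrow> ennreal" where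
  "survival F l \<Theta> a 0 v = 1"
| "survival F l \<Theta> a (Suc n) v = (\<integral>\<^sup>+x. of_bool (\<forall>\<theta>\<in>\<Theta>. max 0 (v \<theta>) + l \<theta> x < a) *
     survival F l \<Theta> a n (\<lambda>\<theta>\<in>\<Theta>. max 0 (v \<theta>) + l \<theta> x) \<partial>F)"

text \<open>A skip turns the state into its positive part, and survival cannot tell the two
  apart.\<close>

lemma survival_truncate: "survival F l \<Theta> a n (\<lambda>\<theta>\<in>\<Theta>. max 0 (v \<theta>)) = survival F l \<Theta> a n v"
  by (cases n) (simp_all cong: restrict_cong)

context
  fixes F :: "'a measure" and l :: "'p \<Rightarrow> 'a \<Rightarrow> real" and \<Theta> :: "'p set"
  assumes F: "prob_space F" and l[measurable]: "\<And>\<theta>. \<theta> \<in> \<Theta> \<Longrightarrow> l \<theta> \<in> borel_measurable F"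
    and fin: "finite \<Theta>"
begin

lemma measurable_survival[measurable]: "survival F l \<Theta> a n \<in> borel_measurable (\<Pi>\<^sub>M \<theta>\<in>\<Theta>. borel)"
proof (induction n)
  case (Suc n)
  note [measurable] = Suc
  interpret prob_space F by fact
  have [measurable]: "(\<lambda>v. v \<theta>) \<in> borel_measurable (\<Pi>\<^sub>M \<theta>\<in>\<Theta>. (borel :: real measure))" if "\<theta> \<in> \<Theta>" for \<theta>
    using that by (rule measurable_component_singleton)
  have [measurable]: "Measurable.pred ((\<Pi>\<^sub>M \<theta>\<in>\<Theta>. borel) \<Otimes>\<^sub>M F) (\<lambda>(v, x). \<forall>\<theta>\<in>\<Theta>. max 0 (v \<theta>) + l \<theta> x < a)"
    unfolding case_prod_beta' by (intro pred_intros_finite fin) measurable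
  have [measurable]: "(\<lambda>(v, x). \<lambda>\<theta>\<in>\<Theta>. max 0 (v \<theta>) + l \<theta> x) \<in> (\<Pi>\<^sub>M \<theta>\<in>\<Theta>. borel) \<Otimes>\<^sub>M F \<rightarrow>\<^sub>M (\<Pi>\<^sub>M \<theta>\<in>\<Theta>. borel)"
    unfolding case_prod_beta' by (intro measurable_restrict) measurable
  show ?case unfolding survival.simps by measurable
qed simp

lemma survival_Suc_le: "survival F l \<Theta> a (Suc n) v \<le> survival F l \<Theta> a n v"
proof (induction n arbitrary: v)
  case 0
  interpret prob_space F by fact
  show ?case
    using nn_integral_mono[of F "\<lambda>x. of_bool (\<forall>\<theta>\<in>\<Theta>. max 0 (v \<theta>) + l \<theta> x < a)" "\<lambda>_. 1"]
    by (simp add: emeasure_space_1)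
next
  case (Suc n)
  show ?case by (subst (1 2) survival.simps) (intro nn_integral_mono mult_left_mono Suc zero_le)
qed

end

context observations
begin

lemma suminf_of_bool_below:
  "(\<Sum>n. \<integral>\<^sup>+\<xi>. of_bool (below S l \<Theta> a n \<xi>) \<partial>P) = (\<integral>\<^sup>+\<xi>. (\<Sum>n. of_bool (below S l \<Theta> a n \<xi>)) \<partial>P)"
  by (rule nn_integral_suminf[symmetric]) measurable

text \<open>\<open>\<Phi> k j\<close> runs the actual procedure for \<open>k\<close> steps and then
  observes \<open>j\<close> samples without skips. An observed step is exactly one step of the
  recursion. A skipped one leaves an equivalent state with one sample fewer to survive, so the
  probability can only grow.\<close>

lemma survival_step:
  fixes V \<Phi> and F :: "'a measure" and a :: real
  defines "V \<equiv> \<lambda>k \<xi>. \<lambda>\<theta>\<in>\<Theta>. cusum S (l \<theta>) k \<xi>"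
  defines "\<Phi> \<equiv> \<lambda>k j. \<integral>\<^sup>+\<xi>. of_bool (below S l \<Theta> a k \<xi>) * survival F l \<Theta> a j (V k \<xi>) \<partial>P"
  assumes N: "N (Suc k) = F" and a: "0 < a"
  shows "\<Phi> k (Suc j) \<le> \<Phi> (Suc k) j"
    and "(\<And>\<xi>. S (Suc k) \<xi>) \<Longrightarrow> \<Phi> k (Suc j) = \<Phi> (Suc k) j"
proof -
  have F: "prob_space F" using prob_N N by metis
  interpret F: prob_space F by fact
  have setsF[measurable_cong]: "sets F = sets \<nu>" using sets_N N by metis
  have lF[measurable]: "\<theta> \<in> \<Theta> \<Longrightarrow> l \<theta> \<in> borel_measurable F" for \<theta> by measurable
  note [measurable] = measurable_survival[OF F lF finite_\<Theta>]
  have [measurable]: "V k \<in> P \<rightarrow>\<^sub>M (\<Pi>\<^sub>M \<theta>\<in>\<Theta>. borel)" for k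
    unfolding V_def by (intro measurable_restrict) measurable
  define next_V where "next_V \<xi> x = (\<lambda>\<theta>\<in>\<Theta>. max 0 (V k \<xi> \<theta>) + l \<theta> x)" for \<xi> x
  have [measurable]: "next_V \<xi> \<in> F \<rightarrow>\<^sub>M (\<Pi>\<^sub>M \<theta>\<in>\<Theta>. borel)" for \<xi>
    unfolding next_V_def by (intro measurable_restrict) measurable
  have [measurable]: "Measurable.pred F (\<lambda>x. \<forall>\<theta>\<in>\<Theta>. max 0 (V k \<xi> \<theta>) + l \<theta> x < a)" for \<xi>
    by (intro pred_intros_finite finite_\<Theta>) measurable
  have B: "\<Phi> (Suc k) j = (\<integral>\<^sup>+\<xi>. \<integral>\<^sup>+x. of_bool (below S l \<Theta> a (Suc k) (\<xi>(Suc k := x)))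
       * survival F l \<Theta> a j (V (Suc k) (\<xi>(Suc k := x))) \<partial>F \<partial>P)"
    unfolding \<Phi>_def by (subst resample[where n=k]) (simp_all only: N, measurable)
  have obs: "(\<integral>\<^sup>+x. of_bool (below S l \<Theta> a (Suc k) (\<xi>(Suc k := x)))
       * survival F l \<Theta> a j (V (Suc k) (\<xi>(Suc k := x))) \<partial>F)
     = of_bool (below S l \<Theta> a k \<xi>) * survival F l \<Theta> a (Suc j) (V k \<xi>)" if "S (Suc k) \<xi>" for \<xi>
  proof -
    have "V (Suc k) (\<xi>(Suc k := x)) = next_V \<xi> x" for x
      unfolding V_def next_V_def cusum_Suc_resample using that by (auto cong: restrict_cong)
    moreover have "below S l \<Theta> a (Suc k) (\<xi>(Suc k := x)) \<longleftrightarrow> below S l \<Theta> a k \<xi> \<and> (\<forall>\<theta>\<in>\<Theta>. max 0 (V k \<xi> \<theta>) + l \<theta> x < a)" for x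
      using that by (simp add: below_Suc_resample V_def)
    ultimately show ?thesis
      by (cases "below S l \<Theta> a k \<xi>") (simp_all add: next_V_def)
  qed
  have skip: "of_bool (below S l \<Theta> a k \<xi>) * survival F l \<Theta> a (Suc j) (V k \<xi>)
     \<le> (\<integral>\<^sup>+x. of_bool (below S l \<Theta> a (Suc k) (\<xi>(Suc k := x)))
       * survival F l \<Theta> a j (V (Suc k) (\<xi>(Suc k := x))) \<partial>F)" if "\<not> S (Suc k) \<xi>" for \<xi>
  proof (cases "below S l \<Theta> a k \<xi>")
    case True
    have "V (Suc k) (\<xi>(Suc k := x)) = (\<lambda>\<theta>\<in>\<Theta>. max 0 (V k \<xi> \<theta>))" for x
      unfolding V_def cusum_Suc_resample using that by (auto cong: restrict_cong)
    \<comment> \<open>A skip cannot cause a crossing: the new value is the positive part of the old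
      one, and \<open>0 < a\<close> covers the value 0.\<close>
    moreover have "below S l \<Theta> a (Suc k) (\<xi>(Suc k := x))" for x
      using that True below_imp_less[OF True a] by (simp add: below_Suc_resample)
    ultimately show ?thesis
      using survival_Suc_le[OF F lF finite_\<Theta>] by (simp add: survival_truncate True F.emeasure_space_1 del: survival.simps)
  qed simp
  show "\<Phi> k (Suc j) \<le> \<Phi> (Suc k) j" unfolding B unfolding \<Phi>_def
  proof (rule nn_integral_mono, goal_cases)
    case (1 \<xi>)
    show ?case
    proof (cases "S (Suc k) \<xi>")
      case True
      show ?thesis unfolding obs[OF True] by (rule order_refl)
    qed (rule skip)
  qed
  show "\<Phi> k (Suc j) = \<Phi> (Suc k) j" if "\<And>\<xi>. S (Suc k) \<xi>"
    unfolding B obs[OF that] unfolding \<Phi>_def by (rule refl)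
qed

text \<open>Interpolation over the number \<open>k\<close> of actual steps among \<open>n\<close>:
  \<open>\<Phi> 0\<close> is the fully observed scheme and \<open>\<Phi> n\<close> the actual
  one.\<close>

lemma survival_0_le:
  assumes N: "\<And>k. N (Suc k) = F" and a: "0 < a"
  shows "survival F l \<Theta> a n (\<lambda>\<theta>\<in>\<Theta>. 0) \<le> (\<integral>\<^sup>+\<xi>. of_bool (below S l \<Theta> a n \<xi>) \<partial>P)" (is ?le)
    and "(\<And>k \<xi>. S (Suc k) \<xi>) \<Longrightarrow> survival F l \<Theta> a n (\<lambda>\<theta>\<in>\<Theta>. 0) = (\<integral>\<^sup>+\<xi>. of_bool (below S l \<Theta> a n \<xi>) \<partial>P)"
proof -
  define \<Phi> where "\<Phi> k = (\<integral>\<^sup>+\<xi>. of_bool (below S l \<Theta> a k \<xi>)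
    * survival F l \<Theta> a (n - k) (\<lambda>\<theta>\<in>\<Theta>. cusum S (l \<theta>) k \<xi>) \<partial>P)" for k
  have ends: "\<Phi> 0 = survival F l \<Theta> a n (\<lambda>\<theta>\<in>\<Theta>. 0)" "\<Phi> n = (\<integral>\<^sup>+\<xi>. of_bool (below S l \<Theta> a n \<xi>) \<partial>P)"
    by (simp_all add: \<Phi>_def P.emeasure_space_1)
  have diff: "n - k = Suc (n - Suc k)" if "k < n" for k using that by simp
  have "\<Phi> 0 \<le> \<Phi> k" if "k \<le> n" for k
    using that
  proof (induction k)
    case (Suc k)
    then have "\<Phi> k \<le> \<Phi> (Suc k)"
      unfolding \<Phi>_def by (subst diff) (auto intro!: survival_step(1) N a simp del: cusum.simps survival.simps)
    with Suc show ?case by simp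
  qed simp
  from this[of n] show ?le by (simp only: ends order_refl)
  show "survival F l \<Theta> a n (\<lambda>\<theta>\<in>\<Theta>. 0) = (\<integral>\<^sup>+\<xi>. of_bool (below S l \<Theta> a n \<xi>) \<partial>P)" if S: "\<And>k \<xi>. S (Suc k) \<xi>"
  proof -
    have "\<Phi> 0 = \<Phi> k" if "k \<le> n" for k
      using that
    proof (induction k)
      case (Suc k)
      then have "\<Phi> k = \<Phi> (Suc k)"
        unfolding \<Phi>_def by (subst diff) (auto intro!: survival_step(2) N a S simp del: cusum.simps survival.simps)
      with Suc show ?case by simp
    qed simp
    from this[of n] show ?thesis by (simp only: ends order_refl)
  qed
qed

end

text \<open>\<open>survival\<close> mediates: for every \<open>n\<close> it equals the probability
  of not having stopped under full observation and is at most that probability under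
  \<open>S\<close>.\<close>

lemma skipping_delays_stopping:
  assumes S: "observations \<nu> (\<lambda>_. F) S l \<Theta>" and full: "observations \<nu> (\<lambda>_. F) (\<lambda>_ _. True) l \<Theta>"
    and a: "0 < a"
  shows "(\<Sum>n. \<integral>\<^sup>+\<xi>. of_bool (below (\<lambda>_ _. True) l \<Theta> a n \<xi>) \<partial>PiM {1..} (\<lambda>_. F))
    \<le> (\<Sum>n. \<integral>\<^sup>+\<xi>. of_bool (below S l \<Theta> a n \<xi>) \<partial>PiM {1..} (\<lambda>_. F))"
proof (intro suminf_le summableI)
  fix n
  have "survival F l \<Theta> a n (\<lambda>\<theta>\<in>\<Theta>. 0)
      = (\<integral>\<^sup>+\<xi>. of_bool (below (\<lambda>_ _. True) l \<Theta> a n \<xi>) \<partial>PiM {1..} (\<lambda>_. F))"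
    by (intro observations.survival_0_le(2)[OF full] a) simp_all
  moreover have "survival F l \<Theta> a n (\<lambda>\<theta>\<in>\<Theta>. 0)
      \<le> (\<integral>\<^sup>+\<xi>. of_bool (below S l \<Theta> a n \<xi>) \<partial>PiM {1..} (\<lambda>_. F))"
    by (intro observations.survival_0_le(1)[OF S] a) simp_all
  ultimately show "(\<integral>\<^sup>+\<xi>. of_bool (below (\<lambda>_ _. True) l \<Theta> a n \<xi>) \<partial>PiM {1..} (\<lambda>_. F))
      \<le> (\<integral>\<^sup>+\<xi>. of_bool (below S l \<Theta> a n \<xi>) \<partial>PiM {1..} (\<lambda>_. F))" by simp
qed

subsection \<open>Skipped samples after the change\<close>

text \<open>
  \<open>v w\<close> is the probability that the walk with increments \<open>Y\<close> started at \<open>w\<close> ever becomes negative.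
  That \<open>v 0 < 1\<close> is Garsia's proof of the maximal ergodic lemma: otherwise
  $E[Y; M_n > 0] \le 0$ for the running maxima $M_n$ of the negated walk gives $E[Y] \le 0$.
\<close>

lemma ruin_probability:
  fixes Y :: "'a \<Rightarrow> real"
  assumes F: "prob_space F" and Y: "integrable F Y" and pos: "0 < (\<integral>x. Y x \<partial>F)"
  obtains v :: "real \<Rightarrow> ennreal" where "v \<in> borel_measurable borel" "\<And>w. v w \<le> 1" "v 0 < 1"
    "\<And>w. w < 0 \<Longrightarrow> v w = 1" "\<And>w. 0 \<le> w \<Longrightarrow> (\<integral>\<^sup>+x. v (w + Y x) \<partial>F) = v w"
proof -
  interpret F: prob_space F by fact
  interpret sequence_space F ..
  have [measurable]: "Y \<in> borel_measurable F" using Y by measurable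
  define shift where "shift \<xi> = (\<lambda>i. \<xi> (Suc i))" for \<xi> :: "nat \<Rightarrow> 'a"
  \<comment> \<open>Running maxima of the negated walk, built by prepending the first increment
    rather than appending the last, so that first-step analysis and shift invariance apply directly.
    For \<open>w\<close> \<ge> 0 the walk from \<open>w\<close> goes below 0 iff some
    \<open>M n\<close> exceeds \<open>w\<close>.\<close>
  define M where "M = rec_nat (\<lambda>_. 0) (\<lambda>_ m \<xi>. max 0 (m (shift \<xi>) - Y (\<xi> 0)))"
  have M0: "M 0 \<xi> = 0" and MSuc: "M (Suc n) \<xi> = max 0 (M n (shift \<xi>) - Y (\<xi> 0))" for n \<xi>
    by (simp_all add: M_def)
  have [measurable]: "shift \<in> S \<rightarrow>\<^sub>M S"
    unfolding shift_def by (intro measurable_PiM_single') (auto simp: space_PiM)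
  have [measurable]: "M n \<in> borel_measurable S" for n
  proof (induction n)
    case (Suc n)
    note [measurable] = Suc
    show ?case unfolding MSuc by measurable
  qed (simp add: M0)
  have shift_case[simp]: "shift (case_nat x \<xi>) = \<xi>" for x \<xi> by (simp add: shift_def)
  have first_step: "(\<integral>\<^sup>+\<xi>. g \<xi> \<partial>S) = (\<integral>\<^sup>+x. \<integral>\<^sup>+\<xi>. g (case_nat x \<xi>) \<partial>S \<partial>F)"
    if [measurable]: "g \<in> borel_measurable S" for g
    by (subst PiM_iter[symmetric], subst nn_integral_distr)
      (simp_all add: nn_integral_fst[symmetric] case_prod_beta')
  have M_nonneg: "0 \<le> M n \<xi>" for n \<xi> by (cases n) (auto simp: M0 MSuc)
  have M_mono: "M n \<xi> \<le> M (Suc n) \<xi>" for n \<xi>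
  proof (induction n arbitrary: \<xi>)
    case 0
    then show ?case by (simp add: M0 M_nonneg)
  next
    case (Suc n)
    show ?case by (subst (1 2) MSuc) (intro max.mono order_refl diff_right_mono Suc)
  qed
  define v where "v w = (\<integral>\<^sup>+\<xi>. of_bool (\<exists>n. w < M n \<xi>) \<partial>S)" for w
  have vm: "v \<in> borel_measurable borel" unfolding v_def by measurable
  have v1: "v w \<le> 1" for w
    using nn_integral_mono[of S "\<lambda>\<xi>. of_bool (\<exists>n. w < M n \<xi>)" "\<lambda>_. 1"]
    by (simp add: v_def P.emeasure_space_1)
  have vneg: "v w = 1" if "w < 0" for w
  proof -
    have "\<exists>n. w < M n \<xi>" for \<xi> using that M0 by metis
    then show ?thesis by (simp add: v_def P.emeasure_space_1)
  qed
  have vharm: "(\<integral>\<^sup>+x. v (w + Y x) \<partial>F) = v w" if "0 \<le> w" for w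
  proof -
    have "(\<exists>n. w < M n (case_nat x \<xi>)) \<longleftrightarrow> (\<exists>n. w + Y x < M n \<xi>)" for x \<xi>
    proof
      assume "\<exists>n. w < M n (case_nat x \<xi>)"
      then obtain n where "w < M n (case_nat x \<xi>)" by blast
      \<comment> \<open>\<open>M 0\<close> is 0 and cannot exceed a nonnegative \<open>w\<close>, so
        the index is a successor.\<close>
      with that obtain m where "w < M (Suc m) (case_nat x \<xi>)" by (cases n) (auto simp: M0)
      with that show "\<exists>n. w + Y x < M n \<xi>" by (auto simp: MSuc less_max_iff_disj intro!: exI[of _ m])
    next
      assume "\<exists>n. w + Y x < M n \<xi>"
      then obtain n where "w + Y x < M n \<xi>" by blast
      then have "w < M (Suc n) (case_nat x \<xi>)" by (simp add: MSuc less_max_iff_disj)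
      then show "\<exists>n. w < M n (case_nat x \<xi>)" by blast
    qed
    then show ?thesis
      unfolding v_def by (subst (2) first_step) simp_all
  qed
  have shift_S: "distr S S shift = S"
  proof (rule measure_eqI)
    fix A assume "A \<in> sets (distr S S shift)"
    then have [measurable]: "A \<in> sets S" by simp
    have "emeasure (distr S S shift) A = (\<integral>\<^sup>+\<xi>. indicator A (shift \<xi>) \<partial>S)"
      by (subst nn_integral_distr[symmetric, of shift S S]) simp_all
    also have "\<dots> = emeasure S A"
      by (subst first_step) (simp_all add: F.emeasure_space_1)
    finally show "emeasure (distr S S shift) A = emeasure S A" .
  qed simp
  have head_S: "distr S F (\<lambda>\<xi>. \<xi> 0) = F"
    by (rule PiM_component) simp
  have Y0: "integrable S (\<lambda>\<xi>. Y (\<xi> 0))" "(\<integral>\<xi>. Y (\<xi> 0) \<partial>S) = (\<integral>x. Y x \<partial>F)"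
    using integrable_distr_eq[of "\<lambda>\<xi>. \<xi> 0" S F Y] integral_distr[of "\<lambda>\<xi>. \<xi> 0" S F Y] Y
    by (simp_all add: head_S)
  have M_shift: "integrable S (\<lambda>\<xi>. M n (shift \<xi>)) \<longleftrightarrow> integrable S (M n)"
    "(\<integral>\<xi>. M n (shift \<xi>) \<partial>S) = (\<integral>\<xi>. M n \<xi> \<partial>S)" for n
    using integrable_distr_eq[of shift S S "M n"] integral_distr[of shift S S "M n"]
    by (simp_all add: shift_S)
  have M_int: "integrable S (M n)" for n
  proof (induction n)
    case (Suc n)
    then have "integrable S (\<lambda>\<xi>. max 0 (M n (shift \<xi>) - Y (\<xi> 0)))"
      using Y0 M_shift by (intro integrable_max Bochner_Integration.integrable_diff) auto
    then show ?case by (simp add: MSuc)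
  qed (simp add: M0)
  \<comment> \<open>Where \<open>M (Suc n)\<close> is positive it equals the shifted
    \<open>M n\<close> minus the first increment; elsewhere it is 0 and at most the shifted
    \<open>M n\<close>. Taking expectations, the two means of \<open>M n\<close> cancel by shift
    invariance.\<close>
  have hopf: "(\<integral>\<xi>. of_bool (0 < M (Suc n) \<xi>) * Y (\<xi> 0) \<partial>S) \<le> 0" for n
  proof -
    have i: "integrable S (\<lambda>\<xi>. of_bool (0 < M (Suc n) \<xi>) * Y (\<xi> 0))"
      by (rule Bochner_Integration.integrable_bound[OF Y0(1)]) auto
    have "(\<integral>\<xi>. M n \<xi> \<partial>S) \<le> (\<integral>\<xi>. M (Suc n) \<xi> \<partial>S)"
      by (intro integral_mono M_int M_mono)
    also have "\<dots> \<le> (\<integral>\<xi>. M n (shift \<xi>) - of_bool (0 < M (Suc n) \<xi>) * Y (\<xi> 0) \<partial>S)"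
    proof (rule integral_mono[OF M_int])
      show "integrable S (\<lambda>\<xi>. M n (shift \<xi>) - of_bool (0 < M (Suc n) \<xi>) * Y (\<xi> 0))"
        using M_shift(1) M_int i by (intro Bochner_Integration.integrable_diff) auto
      show "M (Suc n) \<xi> \<le> M n (shift \<xi>) - of_bool (0 < M (Suc n) \<xi>) * Y (\<xi> 0)" for \<xi>
        using M_nonneg[of n "shift \<xi>"] unfolding MSuc max_def of_bool_def by (simp split: if_splits)
    qed
    also have "\<dots> = (\<integral>\<xi>. M n \<xi> \<partial>S) - (\<integral>\<xi>. of_bool (0 < M (Suc n) \<xi>) * Y (\<xi> 0) \<partial>S)"
      using i M_int M_shift by (subst Bochner_Integration.integral_diff) auto
    finally show ?thesis by simp
  qed
  have "v 0 \<noteq> 1"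
  proof
    assume "v 0 = 1"
    have m: "{\<xi>\<in>space S. \<exists>n. 0 < M n \<xi>} \<in> sets S" by measurable
    have "v 0 = (\<integral>\<^sup>+\<xi>. indicator {\<xi>\<in>space S. \<exists>n. 0 < M n \<xi>} \<xi> \<partial>S)"
      unfolding v_def by (intro nn_integral_cong) (simp add: indicator_def)
    with \<open>v 0 = 1\<close> have "emeasure S {\<xi>\<in>space S. \<exists>n. 0 < M n \<xi>} = 1"
      using nn_integral_indicator[OF m] by simp
    then have "AE \<xi> in S. \<exists>n. 0 < M n \<xi>"
      by (intro P.AE_I_eq_1) measurable
    \<comment> \<open>\<open>M n\<close> increases with \<open>n\<close>, so almost surely the
      indicator is 1 from some index on.\<close>
    then have lim: "AE \<xi> in S. (\<lambda>n. of_bool (0 < M (Suc n) \<xi>) * Y (\<xi> 0)) \<longlonglongrightarrow> Y (\<xi> 0)"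
    proof eventually_elim
      case (elim \<xi>)
      then obtain n where n: "0 < M n \<xi>" by blast
      have "eventually (\<lambda>m. 0 < M (Suc m) \<xi>) sequentially"
        using eventually_ge_at_top[of n]
      proof eventually_elim
        case (elim m)
        have "incseq (\<lambda>n. M n \<xi>)" using M_mono by (intro incseq_SucI)
        then have "M n \<xi> \<le> M (Suc m) \<xi>" using elim by (intro incseqD[of "\<lambda>n. M n \<xi>"]) simp_all
        then show ?case using n by simp
      qed
      then have "eventually (\<lambda>m. of_bool (0 < M (Suc m) \<xi>) * Y (\<xi> 0) = Y (\<xi> 0)) sequentially"
        by eventually_elim simp
      then show ?case by (rule tendsto_eventually)
    qed
    have "(\<lambda>n. \<integral>\<xi>. of_bool (0 < M (Suc n) \<xi>) * Y (\<xi> 0) \<partial>S) \<longlonglongrightarrow> (\<integral>\<xi>. Y (\<xi> 0) \<partial>S)"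
      by (rule integral_dominated_convergence[OF _ _ integrable_norm[OF Y0(1)] lim]) auto
    then have "(\<integral>\<xi>. Y (\<xi> 0) \<partial>S) \<le> 0"
      using hopf by (intro LIMSEQ_le_const2) auto
    then show False using pos Y0 by simp
  qed
  with v1[of 0] have "v 0 < 1" by (simp add: order_less_le)
  from that[OF vm v1 this vneg vharm] show ?thesis .
qed

section \<open>The observation control for a finite truncation level\<close>

primrec decusum_real :: "('a \<Rightarrow> real) \<Rightarrow> real \<Rightarrow> real \<Rightarrow> nat \<Rightarrow> (nat \<Rightarrow> 'a) \<Rightarrow> real" where
  "decusum_real l \<mu> h 0 \<xi> = 0"
| "decusum_real l \<mu> h (Suc n) \<xi> =
     (if 0 \<le> decusum_real l \<mu> h n \<xi> then max (- h) (decusum_real l \<mu> h n \<xi> + l (\<xi> (Suc n)))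
      else min 0 (decusum_real l \<mu> h n \<xi> + \<mu>))"

lemma decusum_eq_decusum_real:
  "decusum f0 f1 \<mu> (ereal h) n \<xi> = ereal (decusum_real (\<lambda>x. ln (f1 x / f0 x)) \<mu> h n \<xi>)"
  by (induction n) (auto simp: max_def min_def)

lemma decusum_real_ge: "0 \<le> h \<Longrightarrow> 0 \<le> \<mu> \<Longrightarrow> - h \<le> decusum_real l \<mu> h n \<xi>"
  by (induction n) auto

lemma decusum_past: "n < m \<Longrightarrow> decusum f0 f1 \<mu> h n (\<xi>(m := x)) = decusum f0 f1 \<mu> h n \<xi>"
  by (induction n) auto

lemma decusum_real_past: "n < m \<Longrightarrow> decusum_real l \<mu> h n (\<xi>(m := x)) = decusum_real l \<mu> h n \<xi>"
  by (induction n) auto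

lemma decusum_control_past:
  assumes "i \<le> m"
  shows "decusum_control f0 f1 \<mu> h i (\<xi>(m := x)) = decusum_control f0 f1 \<mu> h i \<xi>"
  using assms decusum_past[of "i - 1" m f0 f1 \<mu> h \<xi> x]
  by (cases i) (auto simp: decusum_control_def)

lemma measurable_decusum_real:
  assumes [measurable]: "l \<in> borel_measurable \<nu>" and N: "\<And>i. sets (N i) = sets \<nu>"
  shows "decusum_real l \<mu> h n \<in> borel_measurable (PiM {1..} N)"
proof (induction n)
  case (Suc n)
  note [measurable] = Suc measurable_sample[OF N]
  show ?case unfolding decusum_real.simps by measurable
qed simp

text \<open>
  \<open>\<phi> w\<close> bounds the expected number of samples ever skipped from state \<open>w\<close>. Every undershoot costs at
  most $\lceil h/\mu \rceil$ skipped samples and restarts the statistic at exactly 0, whence the geometric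
  series $\lceil h/\mu \rceil / (1 - v(0))$.
\<close>

lemma skip_potential:
  fixes Y :: "'a \<Rightarrow> real"
  assumes F: "prob_space F" and Y: "integrable F Y" and pos: "0 < (\<integral>x. Y x \<partial>F)"
    and \<mu>: "0 < \<mu>" and h: "0 \<le> h"
  obtains \<phi> :: "real \<Rightarrow> ennreal" and K :: real where "\<phi> \<in> borel_measurable borel"
    "\<And>w. - h \<le> w \<Longrightarrow> \<phi> w \<le> ennreal K"
    "\<And>w. 0 \<le> w \<Longrightarrow> (\<integral>\<^sup>+x. \<phi> (max (- h) (w + Y x)) \<partial>F) \<le> \<phi> w"
    "\<And>w. w < 0 \<Longrightarrow> 1 + \<phi> (min 0 (w + \<mu>)) \<le> \<phi> w"
proof -
  have [measurable]: "Y \<in> borel_measurable F" using Y by measurable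
  obtain v where [measurable]: "v \<in> borel_measurable borel" and v1: "\<And>w. v w \<le> 1" and v0: "v 0 < 1"
    and vneg: "\<And>w. w < 0 \<Longrightarrow> v w = 1" and vharm: "\<And>w. 0 \<le> w \<Longrightarrow> (\<integral>\<^sup>+x. v (w + Y x) \<partial>F) = v w"
    using ruin_probability[OF F Y pos] by blast
  obtain p where vp: "v 0 = ennreal p" "0 \<le> p" "p < 1"
    using v0 by (cases "v 0") (auto simp: ennreal_less_one_iff)
  \<comment> \<open>\<open>R\<close> bounds the skips after one undershoot, and \<open>K\<close>
    solves K = R + p K: after those skips the state is 0, from which another undershoot has
    probability \<open>p\<close>.\<close>
  define R where "R = real_of_int \<lceil>h / \<mu>\<rceil>"
  define K where "K = R / (1 - p)"
  have R: "0 \<le> R" unfolding R_def using h \<mu> by (simp add: order_less_le_trans[of "-1" 0])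
  have K: "0 \<le> K" "R + K * p = K" using vp R by (auto simp: K_def field_simps)
  \<comment> \<open>From \<open>w\<close> \<ge> 0 the whole cost \<open>K\<close> is charged at the
    first undershoot, which has probability \<open>v w\<close>. From \<open>w < 0\<close> the skips
    still due are counted exactly, and the continuation from 0 adds K p.\<close>
  define \<phi> where "\<phi> w = (if 0 \<le> w then ennreal K * v w else ennreal (real_of_int \<lceil>- w / \<mu>\<rceil> + K * p))" for w
  have ceil: "1 \<le> real_of_int \<lceil>- w / \<mu>\<rceil>" if "w < 0" for w
    using that \<mu> by (simp add: divide_neg_pos one_le_ceiling)
  have \<phi>K: "\<phi> w \<le> ennreal K" if "- h \<le> w" for w
  proof (cases "0 \<le> w")
    case True
    then show ?thesis using mult_left_mono[OF v1[of w], of "ennreal K"] by (simp add: \<phi>_def)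
  next
    case False
    have "\<lceil>- w / \<mu>\<rceil> \<le> \<lceil>h / \<mu>\<rceil>" using that \<mu> by (intro ceiling_mono divide_right_mono) auto
    then have "real_of_int \<lceil>- w / \<mu>\<rceil> + K * p \<le> K" using K(2) by (simp add: R_def)
    then show ?thesis using False by (simp add: \<phi>_def ennreal_leI)
  qed
  have \<phi>_nonneg_eq: "\<phi> 0 = ennreal (K * p)" using K vp by (simp add: \<phi>_def ennreal_mult)
  show ?thesis
  proof
    show "\<phi> \<in> borel_measurable borel" unfolding \<phi>_def by measurable
    show "\<phi> w \<le> ennreal K" if "- h \<le> w" for w by (rule \<phi>K[OF that])
    show "(\<integral>\<^sup>+x. \<phi> (max (- h) (w + Y x)) \<partial>F) \<le> \<phi> w" if "0 \<le> w" for w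
    proof -
      \<comment> \<open>Below 0 the truncated state is within \<open>h\<close> of 0 and costs at
        most \<open>K\<close>, while \<open>v\<close> is 1 there. The one-step bound thus reduces to
        the harmonicity of \<open>v\<close>.\<close>
      have "\<phi> (max (- h) y) \<le> ennreal K * v y" for y
      proof (cases "0 \<le> y")
        case True
        then show ?thesis using h by (simp add: \<phi>_def)
      next
        case False
        then show ?thesis using vneg[of y] \<phi>K[of "max (- h) y"] by simp
      qed
      then have "(\<integral>\<^sup>+x. \<phi> (max (- h) (w + Y x)) \<partial>F) \<le> (\<integral>\<^sup>+x. ennreal K * v (w + Y x) \<partial>F)"
        by (intro nn_integral_mono)
      also have "\<dots> = \<phi> w" using vharm[OF that] that by (simp add: nn_integral_cmult \<phi>_def)
      finally show ?thesis .
    qed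
    show "1 + \<phi> (min 0 (w + \<mu>)) \<le> \<phi> w" if "w < 0" for w
    proof (cases "0 \<le> w + \<mu>")
      \<comment> \<open>The last skip: the cut at 0 discards the excess w + \<mu>, so the next state
        is exactly 0.\<close>
      case True
      then have "1 + \<phi> (min 0 (w + \<mu>)) = ennreal 1 + ennreal (K * p)" by (simp add: min_def \<phi>_nonneg_eq)
      also have "\<dots> \<le> \<phi> w"
        using K vp ceil[OF that] that by (subst ennreal_plus[symmetric]) (auto simp: \<phi>_def intro!: ennreal_leI)
      finally show ?thesis .
    next
      case False
      have "- (w + \<mu>) / \<mu> = - w / \<mu> - 1" using \<mu> by (simp add: field_simps)
      then have c: "real_of_int \<lceil>- (w + \<mu>) / \<mu>\<rceil> = real_of_int \<lceil>- w / \<mu>\<rceil> - 1" by simp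
      have "1 + \<phi> (min 0 (w + \<mu>)) = ennreal 1 + ennreal (real_of_int \<lceil>- (w + \<mu>) / \<mu>\<rceil> + K * p)"
        using False by (simp add: min_def \<phi>_def)
      also have "\<dots> = ennreal (1 + (real_of_int \<lceil>- (w + \<mu>) / \<mu>\<rceil> + K * p))"
        using K vp ceil[of "w + \<mu>"] False by (intro ennreal_plus[symmetric]) auto
      also have "\<dots> = \<phi> w" unfolding c using that by (simp add: \<phi>_def)
      finally show ?thesis by simp
    qed
  qed
qed

subsection \<open>Upper bound on the conditional delay\<close>

text \<open>The hypothesis is tested on the event where the conditional expectation exceeds
  \<open>C\<close>. With this, a conditional bound follows from plain integrals over past
  events.\<close>

lemma (in finite_measure_subalgebra) nn_cond_exp_le_const:
  assumes [measurable]: "g \<in> borel_measurable M" and C: "C \<noteq> \<top>"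
    and le: "\<And>B. B \<in> sets F \<Longrightarrow> (\<integral>\<^sup>+x. indicator B x * g x \<partial>M) \<le> C * emeasure M B"
  shows "AE x in M. nn_cond_exp M F g x \<le> C"
proof -
  define B where "B = {x\<in>space F. C < nn_cond_exp M F g x}"
  have B[measurable]: "B \<in> sets F" unfolding B_def by measurable
  then have BM[measurable]: "B \<in> sets M" using subalg by (auto simp: subalgebra_def)
  have fin: "C * emeasure M B \<noteq> \<top>" using C by (simp add: ennreal_mult_eq_top_iff)
  have "C * emeasure M B + (\<integral>\<^sup>+x. indicator B x * (nn_cond_exp M F g x - C) \<partial>M)
      = (\<integral>\<^sup>+x. C * indicator B x + indicator B x * (nn_cond_exp M F g x - C) \<partial>M)"
    by (simp add: nn_integral_add nn_integral_cmult)
  also have "\<dots> = (\<integral>\<^sup>+x. indicator B x * nn_cond_exp M F g x \<partial>M)"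
    by (intro nn_integral_cong) (auto simp: B_def indicator_def intro!: add_diff_inverse_ennreal)
  also have "\<dots> = (\<integral>\<^sup>+x. indicator B x * g x \<partial>M)"
    by (rule nn_cond_exp_intg) measurable
  also have "\<dots> \<le> C * emeasure M B" by (rule le[OF B])
  finally have "(\<integral>\<^sup>+x. indicator B x * (nn_cond_exp M F g x - C) \<partial>M) = 0"
    using fin by (metis add_diff_eq_ennreal add.right_neutral ennreal_add_left_cancel_le le_zero_eq infinity_ennreal_def)
  then have "AE x in M. indicator B x * (nn_cond_exp M F g x - C) = 0"
    by (subst (asm) nn_integral_0_iff_AE) measurable
  then show ?thesis using AE_space
  proof eventually_elim
    case (elim x)
    show ?case
    proof (rule ccontr)
      assume *: "\<not> nn_cond_exp M F g x \<le> C"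
      then have "x \<in> B" using elim(2) subalg by (auto simp: B_def subalgebra_def)
      with elim(1) * C show False by (auto simp: diff_eq_0_iff_ennreal not_le)
    qed
  qed
qed

context observations
begin

text \<open>Measurability with respect to the past, in the form in which resampling can use it. The
  updated sequence stays in the sample space, so the property passes to complements.\<close>

lemma info_past:
  assumes "B \<in> sets (info \<nu> S g)" "g < k" "x \<in> space \<nu>" "\<xi> \<in> space P"
  shows "\<xi>(k := x) \<in> B \<longleftrightarrow> \<xi> \<in> B"
proof -
  have X: "\<xi>(k := x) \<in> space (\<Pi>\<^sub>M n\<in>{1..}. \<nu>)" "\<xi> \<in> space (\<Pi>\<^sub>M n\<in>{1..}. \<nu>)"
    using assms by (auto simp: space_PiM PiE_iff extensional_def sets_eq_imp_space_eq[OF sets_N])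
  have o: "(\<lambda>i\<in>{1..g}. observe S i (\<xi>(k := x))) = (\<lambda>i\<in>{1..g}. observe S i \<xi>)"
    using \<open>g < k\<close> by (auto simp: observe_def S_past intro!: restrict_ext)
  from assms(1) show ?thesis
    unfolding info_def sets_vimage_algebra
  proof (induction rule: sigma_sets.induct)
    case (Basic B)
    then obtain A where "B = (\<lambda>\<xi>. \<lambda>i\<in>{1..g}. observe S i \<xi>) -` A \<inter> space (\<Pi>\<^sub>M n\<in>{1..}. \<nu>)" by blast
    then show ?case by (simp only: vimage_eq Int_iff X o)
  qed (use X in blast)+
qed

text \<open>Each step before the crossing lowers the expected potential by at least 1: an observed
  one through the first term, a skipped one through \<open>Q\<close>, since it leaves the positive
  part of the statistic unchanged. The initial value is bounded by its maximum, hence equally for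
  every past event \<open>B\<close>.\<close>

lemma hitting_time_bound:
  fixes F :: "'a measure" and Q :: "nat \<Rightarrow> (nat \<Rightarrow> 'a) \<Rightarrow> ennreal"
  assumes \<theta>: "\<theta> \<in> \<Theta>" and a: "0 < a" and N: "\<And>n. g \<le> n \<Longrightarrow> N (Suc n) = F"
    and c: "0 \<le> c" and int: "integrable F (\<lambda>x. min (l \<theta> x) c)"
    and m: "0 < m" "m \<le> (\<integral>x. min (l \<theta> x) c \<partial>F)"
    and Q[measurable]: "\<And>n. Q n \<in> borel_measurable P" and QK: "\<And>n \<xi>. Q n \<xi> \<le> K"
    and Qobs: "\<And>n \<xi>. S (Suc n) \<xi> \<Longrightarrow> (\<integral>\<^sup>+x. Q (Suc n) (\<xi>(Suc n := x)) \<partial>F) \<le> Q n \<xi>"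
    and Qskip: "\<And>n \<xi> x. \<not> S (Suc n) \<xi> \<Longrightarrow> 1 + Q (Suc n) (\<xi>(Suc n := x)) \<le> Q n \<xi>"
    and B[measurable]: "B \<in> sets P"
    and past: "\<And>n \<xi> x. g \<le> n \<Longrightarrow> x \<in> space \<nu> \<Longrightarrow> \<xi> \<in> space P \<Longrightarrow> \<xi>(Suc n := x) \<in> B \<longleftrightarrow> \<xi> \<in> B"
  shows "(\<integral>\<^sup>+\<xi>. indicator B \<xi> * (\<Sum>n. of_bool (below S l \<Theta> a (g + n) \<xi>)) \<partial>P)
     \<le> (ennreal ((a + c) / m) + K) * emeasure P B"
proof -
  have F: "prob_space F" and setsF[measurable_cong]: "sets F = sets \<nu>"
    using prob_N[of "Suc g"] sets_N[of "Suc g"] N[of g] by auto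
  interpret F: prob_space F by fact
  define \<Psi> where "\<Psi> n \<xi> = ennreal ((a + c - max 0 (cusum S (l \<theta>) n \<xi>)) / m) + Q n \<xi>" for n \<xi>
  have [measurable]: "\<Psi> n \<in> borel_measurable P" for n
    unfolding \<Psi>_def using \<theta> by measurable
  define e \<beta> where "e n = (\<integral>\<^sup>+\<xi>. of_bool (below S l \<Theta> a n \<xi>) * indicator B \<xi> * \<Psi> n \<xi> \<partial>P)"
    and "\<beta> n = (\<integral>\<^sup>+\<xi>. of_bool (below S l \<Theta> a n \<xi>) * indicator B \<xi> \<partial>P)" for n
  have drift: "(\<integral>\<^sup>+x. \<Psi> (Suc n) (\<xi>(Suc n := x)) \<partial>F) + 1 \<le> \<Psi> n \<xi>"
    if "g \<le> n" "\<xi> \<in> space P" and b: "below S l \<Theta> a n \<xi>" for n \<xi>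
  proof -
    define d where "d = max 0 (cusum S (l \<theta>) n \<xi>)"
    have d: "0 \<le> d" "d < a" using below_imp_less[OF b a \<theta>] by (simp_all add: d_def)
    have upd: "(\<lambda>x. \<xi>(Suc n := x)) \<in> F \<rightarrow>\<^sub>M P"
    proof -
      have "(\<lambda>x. \<xi>(Suc n := x)) \<in> N (Suc n) \<rightarrow>\<^sub>M PiM (insert (Suc n) {1..}) N"
        using that by (intro measurable_fun_upd[where J="{1..}"]) auto
      then show ?thesis using N[OF \<open>g \<le> n\<close>] by (simp add: insert_absorb)
    qed
    show ?thesis
    proof (cases "S (Suc n) \<xi>")
      case True
      \<comment> \<open>Capping the increment at \<open>c\<close> keeps this bound nonnegative when
        the threshold is overshot, because the statistic was below \<open>a\<close>; its mean is
        then an ordinary real integral.\<close>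
      define r where "r x = (a + c - d - min (l \<theta> x) c) / m" for x
      have r: "0 \<le> r x" for x using d m c by (auto simp: r_def min_def)
      have ri: "integrable F r" unfolding r_def using int by auto
      have rI: "(\<integral>x. r x \<partial>F) \<le> (a + c - d) / m - 1"
        unfolding r_def using int m by (simp add: F.prob_space divide_simps)
      have rI0: "0 \<le> (\<integral>x. r x \<partial>F)" using r by (intro Bochner_Integration.integral_nonneg)
      have "(\<integral>\<^sup>+x. \<Psi> (Suc n) (\<xi>(Suc n := x)) \<partial>F) \<le> (\<integral>\<^sup>+x. ennreal (r x) + Q (Suc n) (\<xi>(Suc n := x)) \<partial>F)"
        unfolding \<Psi>_def cusum_Suc_resample using True m
        by (intro nn_integral_mono add_mono order_refl ennreal_leI)
          (auto simp: r_def d_def min_def max_def intro!: divide_right_mono)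
      also have "\<dots> = (\<integral>\<^sup>+x. ennreal (r x) \<partial>F) + (\<integral>\<^sup>+x. Q (Suc n) (\<xi>(Suc n := x)) \<partial>F)"
        using borel_measurable_integrable[OF ri] measurable_compose[OF upd Q]
        by (intro nn_integral_add) (simp_all add: setsF)
      also have "\<dots> \<le> ennreal ((a + c - d) / m - 1) + Q n \<xi>"
        using Qobs[OF True] rI nn_integral_eq_integral[OF ri] r by (intro add_mono) (auto intro!: ennreal_leI)
      finally have "(\<integral>\<^sup>+x. \<Psi> (Suc n) (\<xi>(Suc n := x)) \<partial>F) + 1 \<le> ennreal ((a + c - d) / m - 1) + Q n \<xi> + 1"
        by (rule add_right_mono)
      also have "\<dots> = ennreal ((a + c - d) / m - 1) + ennreal 1 + Q n \<xi>" by (simp add: ac_simps)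
      also have "\<dots> = \<Psi> n \<xi>"
        using rI rI0 by (subst ennreal_plus[symmetric]) (auto simp: \<Psi>_def d_def)
      finally show ?thesis .
    next
      case False
      have "\<Psi> (Suc n) (\<xi>(Suc n := x)) + 1 \<le> \<Psi> n \<xi>" for x
        using add_left_mono[OF Qskip[OF False, of x], of "ennreal ((a + c - max 0 (cusum S (l \<theta>) n \<xi>)) / m)"] False
        unfolding \<Psi>_def cusum_Suc_resample by (simp add: ac_simps)
      then have "(\<integral>\<^sup>+x. \<Psi> (Suc n) (\<xi>(Suc n := x)) + 1 \<partial>F) \<le> (\<integral>\<^sup>+x. \<Psi> n \<xi> \<partial>F)"
        by (intro nn_integral_mono)
      moreover have "(\<integral>\<^sup>+x. \<Psi> (Suc n) (\<xi>(Suc n := x)) + 1 \<partial>F) = (\<integral>\<^sup>+x. \<Psi> (Suc n) (\<xi>(Suc n := x)) \<partial>F) + (\<integral>\<^sup>+x. 1 \<partial>F)"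
        by (intro nn_integral_add measurable_compose[OF upd]) simp_all
      ultimately show ?thesis by (simp add: F.emeasure_space_1)
    qed
  qed
  have step: "e (Suc n) + \<beta> n \<le> e n" if n: "g \<le> n" for n
  proof -
    have "e (Suc n) \<le> (\<integral>\<^sup>+\<xi>. of_bool (below S l \<Theta> a n \<xi>) * indicator B \<xi> * \<Psi> (Suc n) \<xi> \<partial>P)"
      unfolding e_def by (intro nn_integral_mono mult_right_mono) (auto simp: below_Suc simp del: cusum.simps)
    also have "\<dots> = (\<integral>\<^sup>+\<xi>. \<integral>\<^sup>+x. of_bool (below S l \<Theta> a n \<xi>) * indicator B (\<xi>(Suc n := x)) * \<Psi> (Suc n) (\<xi>(Suc n := x)) \<partial>F \<partial>P)"
      by (subst resample[where n=n]) (simp_all add: below_past N[OF n])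
    also have "\<dots> = (\<integral>\<^sup>+\<xi>. \<integral>\<^sup>+x. of_bool (below S l \<Theta> a n \<xi>) * indicator B \<xi> * \<Psi> (Suc n) (\<xi>(Suc n := x)) \<partial>F \<partial>P)"
      using past[OF n] by (intro nn_integral_cong) (auto simp: indicator_def sets_eq_imp_space_eq[OF setsF])
    finally have "e (Suc n) + \<beta> n \<le> (\<integral>\<^sup>+\<xi>. \<integral>\<^sup>+x. of_bool (below S l \<Theta> a n \<xi>) * indicator B \<xi> * \<Psi> (Suc n) (\<xi>(Suc n := x)) \<partial>F \<partial>P) + \<beta> n"
      by (rule add_right_mono)
    also have "\<dots> = (\<integral>\<^sup>+\<xi>. (\<integral>\<^sup>+x. of_bool (below S l \<Theta> a n \<xi>) * indicator B \<xi> * \<Psi> (Suc n) (\<xi>(Suc n := x)) \<partial>F)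
         + of_bool (below S l \<Theta> a n \<xi>) * indicator B \<xi> \<partial>P)"
    proof -
      have [measurable]: "(\<lambda>(\<xi>, x). \<xi>(Suc n := x)) \<in> P \<Otimes>\<^sub>M F \<rightarrow>\<^sub>M P"
        using measurable_add_dim[of "Suc n" "{1..}" N] N[OF n] by (simp add: insert_absorb)
      show ?thesis unfolding \<beta>_def by (rule nn_integral_add[symmetric]) measurable
    qed
    also have "\<dots> \<le> e n"
      unfolding e_def using drift[OF n] by (intro nn_integral_mono) (auto simp: indicator_def of_bool_def)
    finally show ?thesis .
  qed
  have "e (g + k) + (\<Sum>n<k. \<beta> (g + n)) \<le> e g" for k
  proof (induction k)
    case (Suc k)
    have "e (g + Suc k) + (\<Sum>n<Suc k. \<beta> (g + n)) = (e (Suc (g + k)) + \<beta> (g + k)) + (\<Sum>n<k. \<beta> (g + n))"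
      by (simp add: ac_simps)
    also have "\<dots> \<le> e (g + k) + (\<Sum>n<k. \<beta> (g + n))" by (rule add_right_mono[OF step]) simp
    also have "\<dots> \<le> e g" by (rule Suc)
    finally show ?case .
  qed simp
  then have sums: "(\<Sum>n<k. \<beta> (g + n)) \<le> e g" for k
    using order_trans[OF add_increasing[OF zero_le order_refl]] by blast
  have "e g \<le> (\<integral>\<^sup>+\<xi>. (ennreal ((a + c) / m) + K) * indicator B \<xi> \<partial>P)"
    unfolding e_def \<Psi>_def using m
    by (intro nn_integral_mono) (auto simp: indicator_def of_bool_def intro!: add_mono QK ennreal_leI divide_right_mono)
  then have eg: "e g \<le> (ennreal ((a + c) / m) + K) * emeasure P B"
    by (simp add: nn_integral_cmult_indicator)
  have "(\<integral>\<^sup>+\<xi>. indicator B \<xi> * (\<Sum>n. of_bool (below S l \<Theta> a (g + n) \<xi>)) \<partial>P)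
      = (\<integral>\<^sup>+\<xi>. (\<Sum>n. of_bool (below S l \<Theta> a (g + n) \<xi>) * indicator B \<xi>) \<partial>P)"
    by (intro nn_integral_cong) (simp add: mult.commute)
  also have "\<dots> = (\<Sum>n. \<beta> (g + n))"
    unfolding \<beta>_def by (rule nn_integral_suminf) measurable
  also have "\<dots> \<le> e g" unfolding suminf_eq_SUP using sums by (intro SUP_least)
  finally show ?thesis using eg by simp
qed

lemma cond_delay_bound:
  fixes F :: "'a measure" and Q :: "nat \<Rightarrow> (nat \<Rightarrow> 'a) \<Rightarrow> ennreal" and T :: "(nat \<Rightarrow> 'a) \<Rightarrow> enat"
  assumes \<theta>: "\<theta> \<in> \<Theta>" and a: "0 < a" and N: "\<And>n. g \<le> n \<Longrightarrow> N (Suc n) = F"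
    and c: "0 \<le> c" and int: "integrable F (\<lambda>x. min (l \<theta> x) c)"
    and m: "0 < m" "m \<le> (\<integral>x. min (l \<theta> x) c \<partial>F)"
    and Q: "\<And>n. Q n \<in> borel_measurable P" "\<And>n \<xi>. Q n \<xi> \<le> ennreal K"
      "\<And>n \<xi>. S (Suc n) \<xi> \<Longrightarrow> (\<integral>\<^sup>+x. Q (Suc n) (\<xi>(Suc n := x)) \<partial>F) \<le> Q n \<xi>"
      "\<And>n \<xi> x. \<not> S (Suc n) \<xi> \<Longrightarrow> 1 + Q (Suc n) (\<xi>(Suc n := x)) \<le> Q n \<xi>"
    and T: "\<And>n \<xi>. enat n < T \<xi> \<longleftrightarrow> below S l \<Theta> a n \<xi>"
    and sub: "subalgebra P (info \<nu> S g)"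
  shows "esssup P (nn_cond_exp P (info \<nu> S g) (\<lambda>\<xi>. ennreal_of_enat (T \<xi> - enat (Suc g))))
     \<le> ennreal ((a + c) / m) + ennreal K"
proof -
  interpret finite_measure_subalgebra P "info \<nu> S g"
    by unfold_locales (rule sub)
  \<comment> \<open>Counting from \<open>g\<close> instead of the change time g + 1 adds at most one
    step. It matches the conditioning, which ends at \<open>g\<close>, and the first post-change
    sample, which has index g + 1.\<close>
  have Tle: "ennreal_of_enat (T \<xi> - enat (Suc g)) \<le> (\<Sum>n. of_bool (below S l \<Theta> a (g + n) \<xi>))" for \<xi>
    unfolding ennreal_of_enat_eq_suminf T[symmetric]
  proof (intro suminf_le summableI)
    fix n
    have "enat n < T \<xi> - enat (Suc g) \<Longrightarrow> enat (g + n) < T \<xi>" by (cases "T \<xi>") auto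
    then show "of_bool (enat n < T \<xi> - enat (Suc g)) \<le> (of_bool (enat (g + n) < T \<xi>) :: ennreal)" by auto
  qed
  have [measurable]: "(\<lambda>\<xi>. ennreal_of_enat (T \<xi> - enat (Suc g))) \<in> borel_measurable P"
  proof -
    have "enat n < T \<xi> - enat (Suc g) \<longleftrightarrow> enat (Suc g + n) < T \<xi>" for n \<xi>
      by (cases "T \<xi>") auto
    then show ?thesis unfolding ennreal_of_enat_eq_suminf by (simp only: T) measurable
  qed
  have "AE \<xi> in P. nn_cond_exp P (info \<nu> S g) (\<lambda>\<xi>. ennreal_of_enat (T \<xi> - enat (Suc g))) \<xi> \<le> ennreal ((a + c) / m) + ennreal K"
  proof (rule nn_cond_exp_le_const)
    fix B assume B: "B \<in> sets (info \<nu> S g)"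
    then have BP: "B \<in> sets P" using sub by (auto simp: subalgebra_def)
    have "(\<integral>\<^sup>+\<xi>. indicator B \<xi> * ennreal_of_enat (T \<xi> - enat (Suc g)) \<partial>P)
       \<le> (\<integral>\<^sup>+\<xi>. indicator B \<xi> * (\<Sum>n. of_bool (below S l \<Theta> a (g + n) \<xi>)) \<partial>P)"
      by (intro nn_integral_mono mult_left_mono Tle) simp
    also have "\<dots> \<le> (ennreal ((a + c) / m) + ennreal K) * emeasure P B"
      by (rule hitting_time_bound[OF \<theta> a N c int m Q BP info_past[OF B]]) auto
    finally show "(\<integral>\<^sup>+\<xi>. indicator B \<xi> * ennreal_of_enat (T \<xi> - enat (Suc g)) \<partial>P)
       \<le> (ennreal ((a + c) / m) + ennreal K) * emeasure P B" .
  qed simp_all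
  then show ?thesis by (intro esssup_I) measurable
qed

end

subsection \<open>Lower bounds on the expected stopping time\<close>

primrec shiryaev_roberts :: "('a \<Rightarrow> real) \<Rightarrow> nat \<Rightarrow> (nat \<Rightarrow> 'a) \<Rightarrow> real" where
  "shiryaev_roberts l 0 \<xi> = 0"
| "shiryaev_roberts l (Suc n) \<xi> = (shiryaev_roberts l n \<xi> + 1) * exp (l (\<xi> (Suc n)))"

lemma shiryaev_roberts_nonneg: "0 \<le> shiryaev_roberts l n \<xi>"
  by (induction n) auto

text \<open>The largest window product is at most the sum of all of them. The induction carries the
  positive part, whose empty window accounts for the additional 1; at index 0 the claim would read 1
  \<le> 0.\<close>

lemma exp_cusum_le_shiryaev_roberts:
  "exp (cusum (\<lambda>n \<xi>. True) l (Suc n) \<xi>) \<le> shiryaev_roberts l (Suc n) \<xi>"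
proof -
  have "exp (max 0 (cusum (\<lambda>n \<xi>. True) l n \<xi>)) \<le> shiryaev_roberts l n \<xi> + 1" for n
  proof (induction n)
    case (Suc n)
    have "exp (cusum (\<lambda>n \<xi>. True) l (Suc n) \<xi>) \<le> shiryaev_roberts l (Suc n) \<xi>"
      using Suc by (simp add: exp_add mult_right_mono)
    then show ?case using shiryaev_roberts_nonneg[of l "Suc n" \<xi>] by (simp only: max_def split: if_split) simp
  qed simp
  then show ?thesis by (simp add: exp_add mult_right_mono)
qed

lemma shiryaev_roberts_past:
  "n < m \<Longrightarrow> shiryaev_roberts l n (\<xi>(m := x)) = shiryaev_roberts l n \<xi>"
  by (induction n) auto

lemma measurable_shiryaev_roberts:
  assumes [measurable]: "l \<in> borel_measurable \<nu>" and N: "\<And>i. sets (N i) = sets \<nu>"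
  shows "shiryaev_roberts l n \<in> borel_measurable (PiM {1..} N)"
proof (induction n)
  case (Suc n)
  note [measurable] = Suc measurable_sample[OF N]
  show ?case unfolding shiryaev_roberts.simps by measurable
qed simp

text \<open>Factoring out the likelihood ratio of \<open>\<theta>0\<close> leaves \<open>y\<close>,
  whose mean is at most \<open>y0\<close>. Jensen's inequality is applied through the tangent of the
  logarithm at \<open>y0\<close>, so only \<open>y\<close> itself has to be integrated.
  \<open>1 \<le> c\<close> keeps the logarithm nonnegative, so \<open>ennreal\<close> cuts nothing
  off.\<close>

lemma expected_ln_mixture_le:
  fixes l :: "'p \<Rightarrow> 'a \<Rightarrow> real" and u :: "'p \<Rightarrow> real"
  assumes F: "prob_space F" and \<Theta>: "finite \<Theta>" "\<theta>0 \<in> \<Theta>"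
    and [measurable]: "\<And>\<theta>. \<theta> \<in> \<Theta> \<Longrightarrow> l \<theta> \<in> borel_measurable F"
    and int: "integrable F (l \<theta>0)"
    and inv: "(\<integral>\<^sup>+x. ennreal (exp (- l \<theta>0 x)) \<partial>F) \<le> 1"
    and ratio: "\<And>\<theta>. \<theta> \<in> \<Theta> \<Longrightarrow> (\<integral>\<^sup>+x. ennreal (exp (l \<theta> x - l \<theta>0 x)) \<partial>F) \<le> 1"
    and u: "\<And>\<theta>. \<theta> \<in> \<Theta> \<Longrightarrow> 0 \<le> u \<theta>" and c: "1 \<le> c"
  shows "(\<integral>\<^sup>+x. ennreal (ln (c + (\<Sum>\<theta>\<in>\<Theta>. u \<theta> * exp (l \<theta> x)))) \<partial>F)
     \<le> ennreal ((\<integral>x. l \<theta>0 x \<partial>F) + ln (c + (\<Sum>\<theta>\<in>\<Theta>. u \<theta>)))"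
proof -
  interpret prob_space F by fact
  note [measurable] = \<open>\<theta>0 \<in> \<Theta>\<close>
  have le1: "integrable F g \<and> (\<integral>x. g x \<partial>F) \<le> 1"
    if "g \<in> borel_measurable F" "\<And>x. 0 \<le> g x" "(\<integral>\<^sup>+x. ennreal (g x) \<partial>F) \<le> 1" for g :: "'a \<Rightarrow> real"
  proof
    show i: "integrable F g"
      using that order_le_less_trans[OF that(3) ennreal_one_less_top] by (intro integrableI_nonneg) auto
    show "(\<integral>x. g x \<partial>F) \<le> 1"
      using that nn_integral_eq_integral[OF i] by simp
  qed
  have i0: "integrable F (\<lambda>x. exp (- l \<theta>0 x))" "(\<integral>x. exp (- l \<theta>0 x) \<partial>F) \<le> 1"
    using le1[of "\<lambda>x. exp (- l \<theta>0 x)"] inv \<Theta> by auto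
  have i: "integrable F (\<lambda>x. exp (l \<theta> x - l \<theta>0 x))" "(\<integral>x. exp (l \<theta> x - l \<theta>0 x) \<partial>F) \<le> 1" if "\<theta> \<in> \<Theta>" for \<theta>
    using le1[of "\<lambda>x. exp (l \<theta> x - l \<theta>0 x)"] ratio that \<Theta> by auto
  define y where "y x = c * exp (- l \<theta>0 x) + (\<Sum>\<theta>\<in>\<Theta>. u \<theta> * exp (l \<theta> x - l \<theta>0 x))" for x
  define y0 where "y0 = c + (\<Sum>\<theta>\<in>\<Theta>. u \<theta>)"
  have y0: "1 \<le> y0" using c u by (simp add: y0_def sum_nonneg add_increasing2)
  have ypos: "0 < y x" for x
    unfolding y_def using c u by (intro add_pos_nonneg sum_nonneg mult_pos_pos mult_nonneg_nonneg) auto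
  have yi: "integrable F y" unfolding y_def using i0 i
    by (intro Bochner_Integration.integrable_add Bochner_Integration.integrable_sum integrable_mult_right) auto
  have "(\<integral>x. y x \<partial>F) = c * (\<integral>x. exp (- l \<theta>0 x) \<partial>F) + (\<Sum>\<theta>\<in>\<Theta>. u \<theta> * (\<integral>x. exp (l \<theta> x - l \<theta>0 x) \<partial>F))"
    unfolding y_def using i0 i
    by (subst Bochner_Integration.integral_add) (auto simp: Bochner_Integration.integral_sum)
  also have "\<dots> \<le> c * 1 + (\<Sum>\<theta>\<in>\<Theta>. u \<theta> * 1)"
    using i0 i u c by (intro add_mono sum_mono mult_left_mono) auto
  finally have yI: "(\<integral>x. y x \<partial>F) \<le> y0" by (simp add: y0_def)
  define U where "U x = l \<theta>0 x + (ln y0 + y x / y0 - 1)" for x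
  have eq: "c + (\<Sum>\<theta>\<in>\<Theta>. u \<theta> * exp (l \<theta> x)) = exp (l \<theta>0 x) * y x" for x
    by (simp add: y_def distrib_left sum_distrib_left exp_diff exp_minus field_simps)
  have le: "ln (c + (\<Sum>\<theta>\<in>\<Theta>. u \<theta> * exp (l \<theta> x))) \<le> U x" for x
  proof -
    have "ln (y x / y0) \<le> y x / y0 - 1" using ypos[of x] y0 by (intro ln_le_minus_one) auto
    moreover have "ln (exp (l \<theta>0 x) * y x) = l \<theta>0 x + ln (y x)" using ypos[of x] by (simp add: ln_mult)
    moreover have "ln (y x / y0) = ln (y x) - ln y0" using ypos[of x] y0 by (simp add: ln_div)
    ultimately show ?thesis unfolding eq by (simp add: U_def)
  qed
  have Ui: "integrable F U" unfolding U_def using int yi by auto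
  have UI: "(\<integral>x. U x \<partial>F) = (\<integral>x. l \<theta>0 x \<partial>F) + (ln y0 + (\<integral>x. y x \<partial>F) / y0 - 1)"
    unfolding U_def using int yi by (simp add: prob_space)
  have ln0: "0 \<le> ln (c + (\<Sum>\<theta>\<in>\<Theta>. u \<theta> * exp (l \<theta> x)))" for x
    using c u by (intro ln_ge_zero) (simp add: sum_nonneg add_increasing2)
  have "(\<integral>\<^sup>+x. ennreal (ln (c + (\<Sum>\<theta>\<in>\<Theta>. u \<theta> * exp (l \<theta> x)))) \<partial>F) \<le> (\<integral>\<^sup>+x. ennreal (U x) \<partial>F)"
    by (intro nn_integral_mono ennreal_leI le)
  also have "\<dots> = ennreal (\<integral>x. U x \<partial>F)"
    using le ln0 by (intro nn_integral_eq_integral Ui) (auto intro: order_trans)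
  also have "\<dots> \<le> ennreal ((\<integral>x. l \<theta>0 x \<partial>F) + ln y0)"
    unfolding UI using yI y0 by (intro ennreal_leI) (simp add: divide_le_eq)
  finally show ?thesis by (simp add: y0_def)
qed

lemma (in observations) expected_stopping_time:
  assumes "\<And>n \<xi>. enat n < T \<xi> \<longleftrightarrow> below S l \<Theta> a n \<xi>"
  shows "(\<integral>\<^sup>+\<xi>. ennreal_of_enat (T \<xi>) \<partial>P) = (\<Sum>n. \<integral>\<^sup>+\<xi>. of_bool (below S l \<Theta> a n \<xi>) \<partial>P)"
  unfolding ennreal_of_enat_eq_suminf assms suminf_of_bool_below ..

text \<open>Under the pre-change law the expected stopping time is thus at least exp(a) / M, which
  is 1 / \<alpha> for the threshold log(M / \<alpha>).\<close>

lemma (in observations) exp_level_le: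
  assumes S: "S = (\<lambda>_ _. True)" and N: "\<And>n. N (Suc n) = F" and ne: "\<Theta> \<noteq> {}"
    and one: "\<And>\<theta>. \<theta> \<in> \<Theta> \<Longrightarrow> (\<integral>\<^sup>+x. ennreal (exp (l \<theta> x)) \<partial>F) \<le> 1"
  shows "ennreal (exp a) \<le> of_nat (card \<Theta>) * (\<Sum>n. \<integral>\<^sup>+\<xi>. of_bool (below S l \<Theta> a n \<xi>) \<partial>P)"
proof -
  have [measurable_cong]: "sets F = sets \<nu>" using sets_N[of "Suc 0"] N by simp
  have [measurable]: "shiryaev_roberts (l \<theta>) n \<in> borel_measurable P" if "\<theta> \<in> \<Theta>" for \<theta> n
    using l_measurable[OF that] by (rule measurable_shiryaev_roberts) (rule sets_N)
  have "ennreal (exp a) \<le> 0 + of_nat (card \<Theta>) * (\<Sum>n. \<integral>\<^sup>+\<xi>. of_bool (below S l \<Theta> a n \<xi>) \<partial>P)"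
  proof (rule stopping_lower_bound[where \<Psi>="\<lambda>n \<xi>. \<Sum>\<theta>\<in>\<Theta>. ennreal (shiryaev_roberts (l \<theta>) n \<xi>)"])
    show "(\<lambda>\<xi>. \<Sum>\<theta>\<in>\<Theta>. ennreal (shiryaev_roberts (l \<theta>) n \<xi>)) \<in> borel_measurable P" for n by measurable
    show "(\<integral>\<^sup>+x. (\<Sum>\<theta>\<in>\<Theta>. ennreal (shiryaev_roberts (l \<theta>) (Suc n) (\<xi>(Suc n := x)))) \<partial>N (Suc n))
        \<le> (\<Sum>\<theta>\<in>\<Theta>. ennreal (shiryaev_roberts (l \<theta>) n \<xi>)) + of_nat (card \<Theta>)" for n \<xi>
    proof -
      define r where "r \<theta> = shiryaev_roberts (l \<theta>) n \<xi>" for \<theta>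
      have r: "0 \<le> r \<theta>" for \<theta> by (simp add: r_def shiryaev_roberts_nonneg)
      have "(\<integral>\<^sup>+x. (\<Sum>\<theta>\<in>\<Theta>. ennreal (shiryaev_roberts (l \<theta>) (Suc n) (\<xi>(Suc n := x)))) \<partial>N (Suc n))
         = (\<integral>\<^sup>+x. (\<Sum>\<theta>\<in>\<Theta>. ennreal (r \<theta> + 1) * ennreal (exp (l \<theta> x))) \<partial>F)"
        using r by (simp add: N shiryaev_roberts_past r_def[symmetric] ennreal_mult)
      also have "\<dots> = (\<Sum>\<theta>\<in>\<Theta>. ennreal (r \<theta> + 1) * (\<integral>\<^sup>+x. ennreal (exp (l \<theta> x)) \<partial>F))"
        by (simp add: nn_integral_sum nn_integral_cmult)
      also have "\<dots> \<le> (\<Sum>\<theta>\<in>\<Theta>. ennreal (r \<theta> + 1) * 1)"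
        using one by (intro sum_mono mult_left_mono) auto
      also have "\<dots> = (\<Sum>\<theta>\<in>\<Theta>. ennreal (r \<theta>)) + of_nat (card \<Theta>)"
        using r by (simp add: sum.distrib)
      finally show ?thesis by (simp add: r_def)
    qed
    show "ennreal (exp a) \<le> (\<Sum>\<theta>\<in>\<Theta>. ennreal (shiryaev_roberts (l \<theta>) (Suc n) \<xi>))"
      if hit: "\<not> below S l \<Theta> a (Suc n) \<xi>" "below S l \<Theta> a n \<xi>" for n \<xi>
    proof -
      obtain \<theta> where \<theta>: "\<theta> \<in> \<Theta>" "a \<le> cusum S (l \<theta>) (Suc n) \<xi>"
        using hit unfolding below_Suc by (auto simp: not_less simp del: cusum.simps)
      have "exp a \<le> exp (cusum S (l \<theta>) (Suc n) \<xi>)" using \<theta> by simp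
      also have "\<dots> \<le> shiryaev_roberts (l \<theta>) (Suc n) \<xi>"
        unfolding S by (rule exp_cusum_le_shiryaev_roberts)
      finally have "ennreal (exp a) \<le> ennreal (shiryaev_roberts (l \<theta>) (Suc n) \<xi>)" by (rule ennreal_leI)
      also have "\<dots> \<le> (\<Sum>\<theta>\<in>\<Theta>. ennreal (shiryaev_roberts (l \<theta>) (Suc n) \<xi>))"
        using \<theta> finite_\<Theta> by (intro member_le_sum) auto
      finally show ?thesis .
    qed
    show "0 < (of_nat (card \<Theta>) :: ennreal)" using ne finite_\<Theta> by (simp add: card_gt_0_iff)
  qed simp_all
  then show ?thesis by simp
qed

text \<open>The parameter \<open>c\<close> trades drift against initial value: a large
  \<open>c\<close> brings the drift close to the divergence at the price of \<open>ln c\<close>,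
  which stays fixed while \<open>a\<close> grows.\<close>

lemma (in observations) level_le:
  assumes S: "S = (\<lambda>_ _. True)" and N: "\<And>n. N (Suc n) = F" and \<theta>0: "\<theta>0 \<in> \<Theta>"
    and int: "integrable F (l \<theta>0)" and pos: "0 < (\<integral>x. l \<theta>0 x \<partial>F)"
    and inv: "(\<integral>\<^sup>+x. ennreal (exp (- l \<theta>0 x)) \<partial>F) \<le> 1"
    and ratio: "\<And>\<theta>. \<theta> \<in> \<Theta> \<Longrightarrow> (\<integral>\<^sup>+x. ennreal (exp (l \<theta> x - l \<theta>0 x)) \<partial>F) \<le> 1"
    and c: "1 \<le> c"
  shows "ennreal a \<le> ennreal (ln c) + ennreal ((\<integral>x. l \<theta>0 x \<partial>F) + card \<Theta> / c)
    * (\<Sum>n. \<integral>\<^sup>+\<xi>. of_bool (below S l \<Theta> a n \<xi>) \<partial>P)"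
proof -
  have F: "prob_space F" using prob_N N by metis
  have [measurable_cong]: "sets F = sets \<nu>" using sets_N[of "Suc 0"] N by simp
  have [measurable]: "shiryaev_roberts (l \<theta>) n \<in> borel_measurable P" if "\<theta> \<in> \<Theta>" for \<theta> n
    using l_measurable[OF that] by (rule measurable_shiryaev_roberts) (rule sets_N)
  define R where "R n \<xi> = (\<Sum>\<theta>\<in>\<Theta>. shiryaev_roberts (l \<theta>) n \<xi>)" for n \<xi>
  have R: "0 \<le> R n \<xi>" for n \<xi> unfolding R_def by (intro sum_nonneg shiryaev_roberts_nonneg)
  have ln_nonneg: "0 \<le> ln (c + R n \<xi>)" for n \<xi> using R[of n \<xi>] c by (intro ln_ge_zero) simp
  show ?thesis
  proof (rule stopping_lower_bound[where \<Psi>="\<lambda>n \<xi>. ennreal (ln (c + R n \<xi>))"])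
    show "(\<lambda>\<xi>. ennreal (ln (c + R n \<xi>))) \<in> borel_measurable P" for n unfolding R_def by measurable
    show "(\<integral>\<^sup>+x. ennreal (ln (c + R (Suc n) (\<xi>(Suc n := x)))) \<partial>N (Suc n))
        \<le> ennreal (ln (c + R n \<xi>)) + ennreal ((\<integral>x. l \<theta>0 x \<partial>F) + card \<Theta> / c)" for n \<xi>
    proof -
      have "(\<integral>\<^sup>+x. ennreal (ln (c + R (Suc n) (\<xi>(Suc n := x)))) \<partial>N (Suc n))
        = (\<integral>\<^sup>+x. ennreal (ln (c + (\<Sum>\<theta>\<in>\<Theta>. (shiryaev_roberts (l \<theta>) n \<xi> + 1) * exp (l \<theta> x)))) \<partial>F)"
        by (simp add: R_def N shiryaev_roberts_past)
      also have "\<dots> \<le> ennreal ((\<integral>x. l \<theta>0 x \<partial>F) + ln (c + (\<Sum>\<theta>\<in>\<Theta>. shiryaev_roberts (l \<theta>) n \<xi> + 1)))"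
        by (intro expected_ln_mixture_le F finite_\<Theta> \<theta>0 int inv ratio c add_nonneg_nonneg shiryaev_roberts_nonneg) simp_all
      also have "\<dots> \<le> ennreal ((\<integral>x. l \<theta>0 x \<partial>F) + (ln (c + R n \<xi>) + card \<Theta> / c))"
      proof (intro ennreal_leI add_left_mono)
        \<comment> \<open>Adding 1 to each of the M summands raises the logarithm by at most M / s,
          and s \<ge> c.\<close>
        define s where "s = c + R n \<xi>"
        have s: "c \<le> s" "0 < s" using R[of n \<xi>] c by (auto simp: s_def)
        have "ln (s + card \<Theta>) = ln (s * (1 + card \<Theta> / s))" using s by (simp add: distrib_left)
        also have "\<dots> = ln s + ln (1 + card \<Theta> / s)"
          using s by (intro ln_mult_pos) (auto intro: add_pos_nonneg)
        also have "ln (1 + card \<Theta> / s) \<le> card \<Theta> / s" using s by (intro ln_add_one_self_le_self) auto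
        also have "card \<Theta> / s \<le> card \<Theta> / c" using s c by (intro divide_left_mono) auto
        finally show "ln (c + (\<Sum>\<theta>\<in>\<Theta>. shiryaev_roberts (l \<theta>) n \<xi> + 1)) \<le> ln (c + R n \<xi>) + card \<Theta> / c"
          by (simp add: s_def R_def sum.distrib add.assoc)
      qed
      also have "\<dots> = ennreal (ln (c + R n \<xi>)) + ennreal ((\<integral>x. l \<theta>0 x \<partial>F) + card \<Theta> / c)"
        using ln_nonneg pos c by (subst ennreal_plus[symmetric]) (auto simp: ac_simps)
      finally show ?thesis .
    qed
    show "ennreal a \<le> ennreal (ln (c + R (Suc n) \<xi>))"
      if hit: "\<not> below S l \<Theta> a (Suc n) \<xi>" "below S l \<Theta> a n \<xi>" for n \<xi>
    proof -
      obtain \<theta> where \<theta>: "\<theta> \<in> \<Theta>" "a \<le> cusum S (l \<theta>) (Suc n) \<xi>"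
        using hit unfolding below_Suc by (auto simp: not_less simp del: cusum.simps)
      have "exp a \<le> exp (cusum S (l \<theta>) (Suc n) \<xi>)" using \<theta> by simp
      also have "\<dots> \<le> shiryaev_roberts (l \<theta>) (Suc n) \<xi>"
        unfolding S by (rule exp_cusum_le_shiryaev_roberts)
      also have "\<dots> \<le> R (Suc n) \<xi>"
        unfolding R_def by (rule member_le_sum[OF \<theta>(1) shiryaev_roberts_nonneg finite_\<Theta>])
      finally have "exp a \<le> c + R (Suc n) \<xi>" using c by simp
      then show ?thesis using R[of "Suc n" \<xi>] c by (intro ennreal_leI) (simp add: ln_ge_iff)
    qed
    show "ennreal (ln (c + R 0 \<xi>)) \<le> ennreal (ln c)" for \<xi> by (simp add: R_def)
    show "0 < ennreal ((\<integral>x. l \<theta>0 x \<partial>F) + card \<Theta> / c)" using pos c by (simp add: add_pos_nonneg)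
  qed simp_all
qed

subsection \<open>Likelihood ratios and Kullback--Leibler divergence\<close>

lemma prob_space_density_of: "prob_density \<nu> p \<Longrightarrow> prob_space (density \<nu> (\<lambda>x. ennreal (p x)))"
  by (intro prob_spaceI) (simp add: prob_density_def emeasure_density cong: nn_integral_cong)

lemma AE_density_pos_of_absolutely_continuous:
  assumes "prob_density \<nu> p" "prob_density \<nu> r"
    and "absolutely_continuous (density \<nu> (\<lambda>x. ennreal (r x))) (density \<nu> (\<lambda>x. ennreal (p x)))"
  shows "AE x in density \<nu> (\<lambda>x. ennreal (p x)). 0 < r x"
proof -
  have [measurable]: "p \<in> borel_measurable \<nu>" "r \<in> borel_measurable \<nu>"
    using assms by (auto simp: prob_density_def)
  have "{x\<in>space \<nu>. \<not> 0 < r x} \<in> null_sets (density \<nu> r)"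
    by (subst null_sets_density_iff) (auto intro!: AE_I2 simp: not_less ennreal_neg)
  then have "{x\<in>space \<nu>. \<not> 0 < r x} \<in> null_sets (density \<nu> p)"
    using assms(3) by (auto simp: absolutely_continuous_def)
  then show ?thesis by (intro AE_I') auto
qed

lemma AE_density_pos_self:
  assumes "prob_density \<nu> p"
  shows "AE x in density \<nu> (\<lambda>x. ennreal (p x)). 0 < p x"
  using assms by (auto simp: prob_density_def AE_density)

text \<open>Only an inequality, because \<open>q\<close> may have mass where \<open>p\<close>
  vanishes. The function \<open>g\<close> allows for ratios written with \<open>exp\<close> and
  \<open>ln\<close>, which are correct only where the densities are positive.\<close>

lemma nn_integral_likelihood_ratio_le_1:
  assumes p: "prob_density \<nu> p" and q: "prob_density \<nu> q"
    and g: "AE x in density \<nu> (\<lambda>x. ennreal (p x)). g x = q x / p x"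
  shows "(\<integral>\<^sup>+x. ennreal (g x) \<partial>density \<nu> (\<lambda>x. ennreal (p x))) \<le> 1"
proof -
  have [measurable]: "p \<in> borel_measurable \<nu>" "q \<in> borel_measurable \<nu>"
    using p q by (auto simp: prob_density_def)
  have "(\<integral>\<^sup>+x. ennreal (g x) \<partial>density \<nu> p) = (\<integral>\<^sup>+x. ennreal (q x / p x) \<partial>density \<nu> p)"
    by (intro nn_integral_cong_AE) (use g in \<open>auto elim: eventually_mono\<close>)
  also have "\<dots> = (\<integral>\<^sup>+x. ennreal (p x) * ennreal (q x / p x) \<partial>\<nu>)"
    by (rule nn_integral_density) measurable
  also have "\<dots> \<le> (\<integral>\<^sup>+x. ennreal (q x) \<partial>\<nu>)"
  proof (intro nn_integral_mono)
    fix x assume x: "x \<in> space \<nu>"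
    then have "0 \<le> p x" "0 \<le> q x" using p q by (auto simp: prob_density_def)
    then show "ennreal (p x) * ennreal (q x / p x) \<le> ennreal (q x)"
      by (cases "p x = 0") (auto simp flip: ennreal_mult)
  qed
  also have "\<dots> = 1" using q by (simp add: prob_density_def)
  finally show ?thesis .
qed

text \<open>Integrability comes for free: a non-integrable function would have Bochner integral 0.\<close>

lemma KL_pos_imp_integrable:
  assumes \<nu>: "sigma_finite_measure \<nu>" and p: "prob_density \<nu> p" and q: "prob_density \<nu> q"
    and fin: "KL_finite \<nu> p q" and pos: "0 < KL \<nu> p q"
  shows "integrable (density \<nu> (\<lambda>x. ennreal (p x))) (\<lambda>x. ln (p x / q x))"
    and "(\<integral>x. ln (p x / q x) \<partial>density \<nu> (\<lambda>x. ennreal (p x))) = KL \<nu> p q"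
proof -
  interpret sigma_finite_measure \<nu> by fact
  have [measurable]: "p \<in> borel_measurable \<nu>" "q \<in> borel_measurable \<nu>"
    and nn: "AE x in \<nu>. 0 \<le> p x" "AE x in \<nu>. 0 \<le> q x"
    using p q by (auto simp: prob_density_def)
  have "AE x in density \<nu> p. 0 < q x"
    using fin by (intro AE_density_pos_of_absolutely_continuous p q) (simp add: KL_finite_def)
  then have "AE x in \<nu>. 0 < p x \<longrightarrow> 0 < q x" by (simp add: AE_density)
  then have ac: "AE x in \<nu>. q x = 0 \<longrightarrow> p x = 0"
    using nn by eventually_elim auto
  have eq: "KL \<nu> p q = (\<integral>x. p x * ln (p x / q x) \<partial>\<nu>)"
    unfolding KL_def using KL_density_density[of "exp 1" q p] nn ac by (simp add: log_def)
  have "integrable \<nu> (\<lambda>x. p x * ln (p x / q x))"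
    using pos not_integrable_integral_eq eq by (metis less_irrefl)
  then show "integrable (density \<nu> (\<lambda>x. ennreal (p x))) (\<lambda>x. ln (p x / q x))"
    using nn by (subst integrable_density) auto
  show "(\<integral>x. ln (p x / q x) \<partial>density \<nu> (\<lambda>x. ennreal (p x))) = KL \<nu> p q"
    unfolding eq using nn by (subst integral_density) auto
qed

subsection \<open>Asymptotics of the worst-case delay\<close>

text \<open>Cutting off large increments bounds the overshoot and costs arbitrarily little
  drift.\<close>

lemma exists_truncation:
  fixes g :: "'a \<Rightarrow> real"
  assumes g: "integrable F g" and m: "m < (\<integral>x. g x \<partial>F)"
  obtains c where "0 \<le> c" "integrable F (\<lambda>x. min (g x) c)" "m \<le> (\<integral>x. min (g x) c \<partial>F)"
proof -
  have [measurable]: "g \<in> borel_measurable F" using g by measurable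
  have i: "integrable F (\<lambda>x. min (g x) (real n))" for n
    by (rule Bochner_Integration.integrable_bound[OF g]) (auto simp: min_def)
  have "(\<lambda>n. \<integral>x. min (g x) (real n) \<partial>F) \<longlonglongrightarrow> (\<integral>x. g x \<partial>F)"
  proof (rule integral_dominated_convergence[OF _ _ integrable_norm[OF g]])
    show "AE x in F. (\<lambda>n. min (g x) (real n)) \<longlonglongrightarrow> g x"
    proof (rule AE_I2)
      fix x
      have "eventually (\<lambda>n. min (g x) (real n) = g x) sequentially"
        using eventually_ge_at_top[of "nat \<lceil>g x\<rceil>"] by eventually_elim linarith
      then show "(\<lambda>n. min (g x) (real n)) \<longlonglongrightarrow> g x" by (rule tendsto_eventually)
    qed
  qed (auto simp: min_def)
  then have "eventually (\<lambda>n. m < (\<integral>x. min (g x) (real n) \<partial>F)) sequentially"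
    using m by (rule order_tendstoD(1))
  then obtain n where "m < (\<integral>x. min (g x) (real n) \<partial>F)"
    by (auto simp: eventually_sequentially)
  then show ?thesis using i[of n] by (intro that[of "real n"]) auto
qed

text \<open>Change time 1 suffices, since an essential supremum of a conditional expectation
  dominates the mean. The summand 1 turns the delay after time 1 back into the stopping
  time.\<close>

lemma expected_stop_time_le_WADD:
  assumes prob: "prob_space (P_change \<nu> f0 f1 1)"
    and sub: "subalgebra (P_change \<nu> f0 f1 1) (info \<nu> (control \<Psi>) 0)"
    and stop: "\<And>n. Measurable.pred (P_change \<nu> f0 f1 1) (\<lambda>\<xi>. enat n < stop_time \<Psi> \<xi>)"
  shows "(\<integral>\<^sup>+\<xi>. ennreal_of_enat (stop_time \<Psi> \<xi>) \<partial>P_change \<nu> f0 f1 1) \<le> 1 + WADD \<nu> f0 f1 \<Psi>"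
proof -
  define P where "P = P_change \<nu> f0 f1 1"
  interpret prob_space P using prob by (simp add: P_def)
  interpret finite_measure_subalgebra P "info \<nu> (control \<Psi>) 0"
    by unfold_locales (use sub in \<open>simp add: P_def\<close>)
  define g where "g \<xi> = ennreal_of_enat (stop_time \<Psi> \<xi> - enat 1)" for \<xi>
  have [measurable]: "Measurable.pred P (\<lambda>\<xi>. enat n < stop_time \<Psi> \<xi>)" for n
    using stop by (simp add: P_def)
  have [measurable]: "g \<in> borel_measurable P"
  proof -
    have "enat n < stop_time \<Psi> \<xi> - enat 1 \<longleftrightarrow> enat (Suc n) < stop_time \<Psi> \<xi>" for n \<xi>
      by (cases "stop_time \<Psi> \<xi>") auto
    then show ?thesis unfolding g_def ennreal_of_enat_eq_suminf by simp
  qed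
  have sup: "esssup P (nn_cond_exp P (info \<nu> (control \<Psi>) 0) g) \<le> WADD \<nu> f0 f1 \<Psi>"
    unfolding WADD_def by (rule SUP_upper2[of 1]) (simp_all add: P_def g_def[abs_def])
  have AE: "AE \<xi> in P. nn_cond_exp P (info \<nu> (control \<Psi>) 0) g \<xi> \<le> WADD \<nu> f0 f1 \<Psi>"
    using esssup_AE by eventually_elim (rule order_trans[OF _ sup])
  have "(\<integral>\<^sup>+\<xi>. g \<xi> \<partial>P) = (\<integral>\<^sup>+\<xi>. nn_cond_exp P (info \<nu> (control \<Psi>) 0) g \<xi> \<partial>P)"
    using nn_cond_exp_intg[of "\<lambda>_. 1" g] by simp
  also have "\<dots> \<le> (\<integral>\<^sup>+\<xi>. WADD \<nu> f0 f1 \<Psi> \<partial>P)" by (rule nn_integral_mono_AE[OF AE])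
  finally have *: "(\<integral>\<^sup>+\<xi>. g \<xi> \<partial>P) \<le> WADD \<nu> f0 f1 \<Psi>" by (simp add: emeasure_space_1)
  have "ennreal_of_enat t \<le> 1 + ennreal_of_enat (t - enat 1)" for t
  proof (cases t)
    case (enat n)
    have "(of_nat n :: ennreal) \<le> of_nat (Suc (n - 1))" by (intro of_nat_mono) simp
    then show ?thesis using enat by simp
  qed simp
  then have "(\<integral>\<^sup>+\<xi>. ennreal_of_enat (stop_time \<Psi> \<xi>) \<partial>P) \<le> (\<integral>\<^sup>+\<xi>. 1 + g \<xi> \<partial>P)"
    unfolding g_def by (intro nn_integral_mono)
  also have "\<dots> \<le> 1 + WADD \<nu> f0 f1 \<Psi>"
    using * by (simp add: nn_integral_add emeasure_space_1)
  finally show ?thesis by (simp add: P_def)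
qed

text \<open>The bound on the conditional delay involves neither the change time nor the past, so it
  survives both suprema.\<close>

lemma WADD_le:
  fixes Q :: "nat \<Rightarrow> (nat \<Rightarrow> 'a) \<Rightarrow> ennreal"
  assumes obs: "\<And>\<gamma>. observations \<nu> (\<lambda>n. density \<nu> (\<lambda>x. ennreal (if n < \<gamma> then f0 x else f1 x))) (control \<Psi>) l \<Theta>"
    and F: "F = density \<nu> (\<lambda>x. ennreal (f1 x))"
    and \<theta>: "\<theta> \<in> \<Theta>" and a: "0 < a"
    and c: "0 \<le> c" and int: "integrable F (\<lambda>x. min (l \<theta> x) c)"
    and m: "0 < m" "m \<le> (\<integral>x. min (l \<theta> x) c \<partial>F)"
    and Q: "\<And>\<gamma> n. Q n \<in> borel_measurable (P_change \<nu> f0 f1 \<gamma>)" "\<And>n \<xi>. Q n \<xi> \<le> ennreal K"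
      "\<And>n \<xi>. control \<Psi> (Suc n) \<xi> \<Longrightarrow> (\<integral>\<^sup>+x. Q (Suc n) (\<xi>(Suc n := x)) \<partial>F) \<le> Q n \<xi>"
      "\<And>n \<xi> x. \<not> control \<Psi> (Suc n) \<xi> \<Longrightarrow> 1 + Q (Suc n) (\<xi>(Suc n := x)) \<le> Q n \<xi>"
    and T: "\<And>n \<xi>. enat n < stop_time \<Psi> \<xi> \<longleftrightarrow> below (control \<Psi>) l \<Theta> a n \<xi>"
    and sub: "\<And>\<gamma> n. subalgebra (P_change \<nu> f0 f1 \<gamma>) (info \<nu> (control \<Psi>) n)"
  shows "WADD \<nu> f0 f1 \<Psi> \<le> ennreal ((a + c) / m) + ennreal K"
  unfolding WADD_def
proof (rule SUP_least)
  fix \<gamma> :: nat assume "\<gamma> \<in> {1..}"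
  then obtain g where g: "\<gamma> = Suc g" by (cases \<gamma>) auto
  have "density \<nu> (\<lambda>x. ennreal (if Suc n < \<gamma> then f0 x else f1 x)) = F" if "g \<le> n" for n
    using that by (simp add: g F)
  from observations.cond_delay_bound[OF obs \<theta> a this c int m Q[unfolded P_change_def] T sub[unfolded P_change_def]]
  show "esssup (P_change \<nu> f0 f1 \<gamma>) (nn_cond_exp (P_change \<nu> f0 f1 \<gamma>) (info \<nu> (control \<Psi>) (\<gamma> - 1))
      (\<lambda>\<omega>. ennreal_of_enat (stop_time \<Psi> \<omega> - enat \<gamma>))) \<le> ennreal ((a + c) / m) + ennreal K"
    unfolding P_change_def g by simp
qed

text \<open>For fixed \<open>c\<close> and \<open>m\<close> the two bounds confine the limit points
  of W(a) / a to the interval from 1 / (D + M / c) to 1 / m. Only afterwards is \<open>c\<close>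
  taken large and \<open>m\<close> close to \<open>D\<close>.\<close>

lemma delay_asymptotics:
  fixes W :: "real \<Rightarrow> ennreal" and M D :: real
  assumes D: "0 < D" and M: "0 < M"
    and lower: "\<And>c a. 1 \<le> c \<Longrightarrow> 0 < a \<Longrightarrow> ennreal a \<le> ennreal (ln c) + ennreal (D + M / c) * (1 + W a)"
    and upper: "\<And>m. 0 < m \<Longrightarrow> m < D \<Longrightarrow> \<exists>b\<ge>0. \<exists>K\<ge>0. \<forall>a>0. W a \<le> ennreal ((a + b) / m) + ennreal K"
  shows "(\<lambda>\<alpha>. enn2real (W (ln (M / \<alpha>)))) \<sim>[at_right 0] (\<lambda>\<alpha>. \<bar>ln \<alpha>\<bar> / D)"
proof -
  define w where "w a = enn2real (W a)" for a
  have up: "\<exists>b\<ge>0. \<exists>K\<ge>0. \<forall>a>0. W a = ennreal (w a) \<and> w a \<le> (a + b) / m + K" if m: "0 < m" "m < D" for m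
  proof -
    obtain b K where bK: "0 \<le> b" "0 \<le> K" "\<And>a. 0 < a \<Longrightarrow> W a \<le> ennreal ((a + b) / m) + ennreal K"
      using upper[OF m] by blast
    have "W a = ennreal (w a) \<and> w a \<le> (a + b) / m + K" if "0 < a" for a
    proof -
      have le: "W a \<le> ennreal ((a + b) / m + K)"
        using bK(3)[OF that] bK(1,2) that \<open>0 < m\<close> by (simp add: ennreal_plus)
      then have "W a \<noteq> \<top>" using neq_top_trans[OF ennreal_neq_top] by blast
      then have eq: "W a = ennreal (w a)" by (simp add: w_def less_top)
      have "ennreal (w a) \<le> ennreal ((a + b) / m + K)" using le by (simp only: eq[symmetric])
      then have "w a \<le> (a + b) / m + K"
        by (subst (asm) ennreal_le_iff) (use bK(1,2) that m in auto)
      with eq show ?thesis by blast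
    qed
    with bK show ?thesis by blast
  qed
  have wnn: "0 \<le> w a" for a by (simp add: w_def)
  have low: "a \<le> ln c + (D + M / c) * (1 + w a)" if "1 \<le> c" "0 < a" for a c
  proof -
    \<comment> \<open>Finiteness of \<open>W a\<close>, by the upper bound at an arbitrary slope in
      (0, D); hence \<open>enn2real\<close> loses nothing.\<close>
    have W: "W a = ennreal (w a)" using up[of "D / 2"] D that by auto
    have "ennreal a \<le> ennreal (ln c) + ennreal (D + M / c) * (ennreal 1 + ennreal (w a))"
      using lower[OF that] by (simp add: W)
    also have "\<dots> = ennreal (ln c + (D + M / c) * (1 + w a))"
      using that D M wnn[of a] by (simp add: ennreal_plus ennreal_mult)
    finally show ?thesis
      by (subst (asm) ennreal_le_iff) (use that D M wnn[of a] in auto)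
  qed
  have "((\<lambda>a. w a / a) \<longlongrightarrow> 1 / D) at_top"
  proof (rule order_tendstoI)
    fix y assume y: "y < 1 / D"
    have "((\<lambda>c. 1 / (D + M / c)) \<longlongrightarrow> 1 / (D + 0)) at_top"
      using D by (intro tendsto_intros tendsto_divide_0[OF tendsto_const filterlim_at_top_imp_at_infinity[OF filterlim_ident]]) auto
    then have "eventually (\<lambda>c. y < 1 / (D + M / c)) at_top"
      using y by (intro order_tendstoD(1)) auto
    with eventually_ge_at_top[of 1] have "eventually (\<lambda>c. 1 \<le> c \<and> y < 1 / (D + M / c)) at_top"
      by eventually_elim simp
    then obtain c where c: "1 \<le> c" "y < 1 / (D + M / c)"
      by (auto simp: eventually_at_top_linorder)
    define r where "r = D + M / c"
    have r: "0 < r" using D M c by (simp add: r_def add_pos_pos)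
    have "((\<lambda>a. ((a - ln c) / r - 1) / a) \<longlongrightarrow> inverse r) at_top"
      using r by real_asymp
    then have "eventually (\<lambda>a. y < ((a - ln c) / r - 1) / a) at_top"
      using c by (intro order_tendstoD(1)) (auto simp: r_def inverse_eq_divide)
    then show "eventually (\<lambda>a. y < w a / a) at_top"
      using eventually_gt_at_top[of 0]
    proof eventually_elim
      case (elim a)
      have "(a - ln c) / r - 1 \<le> w a"
        using low[OF c(1) elim(2)] r by (simp add: r_def[symmetric] field_simps)
      then have "((a - ln c) / r - 1) / a \<le> w a / a" using elim by (intro divide_right_mono) auto
      with elim show ?case by simp
    qed
  next
    fix y assume y: "1 / D < y"
    then have y0: "0 < y" using D by (meson divide_pos_pos less_trans zero_less_one)
    \<comment> \<open>Any slope strictly between 1 / y and \<open>D\<close> serves; the midpoint is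
      taken.\<close>
    define m where "m = (1 / y + D) / 2"
    have "1 / y < D" using y y0 D by (simp add: field_simps)
    then have m: "0 < m" "m < D" "1 / y < m" using y0 D by (auto simp: m_def add_pos_pos)
    then have my: "1 / m < y" using y0 by (simp add: field_simps)
    obtain b K where bK: "0 \<le> b" "0 \<le> K" "\<And>a. 0 < a \<Longrightarrow> w a \<le> (a + b) / m + K"
      using up[OF m(1,2)] by blast
    have "((\<lambda>a. ((a + b) / m + K) / a) \<longlongrightarrow> inverse m) at_top"
      using m(1) by real_asymp
    then have "eventually (\<lambda>a. ((a + b) / m + K) / a < y) at_top"
      using my by (intro order_tendstoD(2)) (auto simp: inverse_eq_divide)
    then show "eventually (\<lambda>a. w a / a < y) at_top"
      using eventually_gt_at_top[of 0]
    proof eventually_elim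
      case (elim a)
      have "w a / a \<le> ((a + b) / m + K) / a" using elim bK(3)[of a] by (intro divide_right_mono) auto
      with elim show ?case by simp
    qed
  qed
  moreover have ln_top: "filterlim (\<lambda>\<alpha>. ln (M / \<alpha>)) at_top (at_right 0)"
    using M by real_asymp
  ultimately have lim: "((\<lambda>\<alpha>. w (ln (M / \<alpha>)) / ln (M / \<alpha>)) \<longlongrightarrow> 1 / D) (at_right 0)"
    by (rule filterlim_compose)
  \<comment> \<open>The factor \<open>M\<close> in the threshold only adds log M, which is
    negligible against the logarithm of \<alpha>.\<close>
  have ratio: "((\<lambda>\<alpha>. ln (M / \<alpha>) / \<bar>ln \<alpha>\<bar>) \<longlongrightarrow> 1) (at_right 0)"
    using M by real_asymp
  have "((\<lambda>\<alpha>. D * (w (ln (M / \<alpha>)) / ln (M / \<alpha>)) * (ln (M / \<alpha>) / \<bar>ln \<alpha>\<bar>)) \<longlongrightarrow> D * (1 / D) * 1) (at_right 0)"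
    by (intro tendsto_intros lim ratio)
  moreover have "eventually (\<lambda>\<alpha>. D * (w (ln (M / \<alpha>)) / ln (M / \<alpha>)) * (ln (M / \<alpha>) / \<bar>ln \<alpha>\<bar>)
      = w (ln (M / \<alpha>)) / (\<bar>ln \<alpha>\<bar> / D)) (at_right 0)"
    using ln_top[THEN filterlim_at_top_dense[THEN iffD1], rule_format, of 0]
    by eventually_elim (use D in \<open>simp add: field_simps\<close>)
  ultimately have "((\<lambda>\<alpha>. w (ln (M / \<alpha>)) / (\<bar>ln \<alpha>\<bar> / D)) \<longlongrightarrow> D * (1 / D) * 1) (at_right 0)"
    by (rule Lim_transform_eventually)
  then show ?thesis
    using D by (intro asymp_equivI') (simp add: w_def)
qed

lemma ennreal_inverse_antimono:
  fixes x y :: ennreal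
  assumes "x \<le> y"
  shows "inverse y \<le> inverse x"
proof (cases "x = 0")
  case False
  then show ?thesis
    using assms by (cases x; cases y) (auto simp: inverse_ennreal top_unique intro!: ennreal_leI le_imp_inverse_le)
qed simp

theorem mainTheorem4:
  fixes \<nu> :: "'a measure"
    and f0 :: "'a \<Rightarrow> real"
    and f :: "'p \<Rightarrow> 'a \<Rightarrow> real"
    and \<Theta> :: "'p set"
    and \<theta>s :: 'p
    and \<mu> :: real
    and h :: ereal
  assumes "sigma_finite_measure \<nu>"
    and "prob_density \<nu> f0"
    and "\<And>\<theta>. \<theta> \<in> \<Theta> \<Longrightarrow> prob_density \<nu> (f \<theta>)"
    and "\<And>\<theta>. \<theta> \<in> \<Theta> \<Longrightarrow> \<not> (AE x in \<nu>. f \<theta> x = f0 x)"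
    and "\<And>\<theta>. \<theta> \<in> \<Theta> \<Longrightarrow> KL_finite \<nu> (f \<theta>) f0 \<and> 0 < KL \<nu> (f \<theta>) f0"
    and "\<And>\<theta>. \<theta> \<in> \<Theta> \<Longrightarrow> KL_finite \<nu> f0 (f \<theta>) \<and> 0 < KL \<nu> f0 (f \<theta>)"
    and "finite \<Theta>"
    and "\<theta>s \<in> \<Theta>"
    and "\<And>\<theta>. \<theta> \<in> \<Theta> \<Longrightarrow> KL_finite \<nu> (f \<theta>) (f \<theta>s)"
    and "\<And>\<theta>. \<theta> \<in> \<Theta> \<Longrightarrow>
           (\<integral>\<omega>. ln (f \<theta>s (\<omega> 1) / f0 (\<omega> 1)) \<partial>P_change \<nu> f0 (f \<theta>) 1)
             = KL \<nu> (f \<theta>) f0 - KL \<nu> (f \<theta>) (f \<theta>s)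
           \<and> 0 < KL \<nu> (f \<theta>) f0 - KL \<nu> (f \<theta>) (f \<theta>s)"
    and "0 < \<mu>"
    and "0 \<le> h"
  defines "A \<equiv> \<lambda>\<alpha>::real. ln (real (card \<Theta>) / \<alpha>)"
  shows "(\<forall>\<alpha>. 0 < \<alpha> \<and> \<alpha> < 1 \<longrightarrow>
            FAR \<nu> f0 (GDECuSum f0 f \<Theta> \<theta>s \<mu> h (A \<alpha>)) \<le> FAR \<nu> f0 (GCuSum f0 f \<Theta> (A \<alpha>))
          \<and> FAR \<nu> f0 (GCuSum f0 f \<Theta> (A \<alpha>)) \<le> ennreal \<alpha>
          \<and> PDC \<nu> f0 (GDECuSum f0 f \<Theta> \<theta>s \<mu> h (A \<alpha>)) = PDC \<nu> f0 (DECuSum f0 (f \<theta>s) \<mu> h (A \<alpha>)))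
       \<and> (h < \<infinity> \<longrightarrow> (\<forall>\<theta>\<in>\<Theta>.
            (\<lambda>\<alpha>. enn2real (WADD \<nu> f0 (f \<theta>) (GDECuSum f0 f \<Theta> \<theta>s \<mu> h (A \<alpha>))))
              \<sim>[at_right 0] (\<lambda>\<alpha>. enn2real (WADD \<nu> f0 (f \<theta>) (GCuSum f0 f \<Theta> (A \<alpha>))))
          \<and> (\<lambda>\<alpha>. enn2real (WADD \<nu> f0 (f \<theta>) (GCuSum f0 f \<Theta> (A \<alpha>))))
              \<sim>[at_right 0] (\<lambda>\<alpha>. \<bar>ln \<alpha>\<bar> / KL \<nu> (f \<theta>) f0)))"
proof -
  note \<nu> = assms(1) and f0 = assms(2) and f = assms(3) and KL1 = assms(5) and KL0 = assms(6)
    and \<theta>s = assms(8) and drift = assms(10) and \<mu> = assms(11) and h = assms(12)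

  \<comment> \<open>Laws and controls covered by the general estimates\<close>
  define l where "l \<theta> x = ln (f \<theta> x / f0 x)" for \<theta> x
  define F0 where "F0 = density \<nu> (\<lambda>x. ennreal (f0 x))"
  define Fd where "Fd \<theta> = density \<nu> (\<lambda>x. ennreal (f \<theta> x))" for \<theta>
  define full where "full = (\<lambda>(_ :: nat) (_ :: nat \<Rightarrow> 'a). True)"
  define ctl where "ctl = decusum_control f0 (f \<theta>s) \<mu> h"
  define M where "M = real (card \<Theta>)"
  have ne: "\<Theta> \<noteq> {}" using \<theta>s by auto
  have "0 < card \<Theta>" using assms(7) ne by (simp add: card_gt_0_iff)
  then have M: "1 \<le> M" unfolding M_def by linarith
  have A_pos: "0 < A \<alpha>" if "0 < \<alpha>" "\<alpha> < 1" for \<alpha>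
    using that M unfolding A_def M_def[symmetric] by (intro ln_gt_zero) (simp add: less_divide_eq)
  have [measurable]: "f0 \<in> borel_measurable \<nu>" using f0 by (simp add: prob_density_def)
  have fm[measurable]: "f \<theta> \<in> borel_measurable \<nu>" if "\<theta> \<in> \<Theta>" for \<theta>
    using f[OF that] by (simp add: prob_density_def)
  have lm[measurable]: "l \<theta> \<in> borel_measurable \<nu>" if "\<theta> \<in> \<Theta>" for \<theta>
    using that unfolding l_def by measurable
  have pF0: "prob_space F0" unfolding F0_def by (rule prob_space_density_of[OF f0])
  have pFd: "prob_space (Fd \<theta>)" if "\<theta> \<in> \<Theta>" for \<theta>
    unfolding Fd_def by (rule prob_space_density_of[OF f[OF that]])
  have ctl_measurable: "Measurable.pred (\<Pi>\<^sub>M k\<in>{1..}. \<nu>) (ctl n)" for n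
    unfolding ctl_def by (intro measurable_decusum_control fm \<theta>s) measurable
  have obs: "observations \<nu> N S l \<Theta>"
    if "\<And>i. prob_space (N i)" "\<And>i. sets (N i) = sets \<nu>" "S = full \<or> S = ctl" for N S
  proof (rule observations.intro)
    have "sets (PiM {1..} N) = sets (\<Pi>\<^sub>M k\<in>{1..}. \<nu>)" using that(2) by (intro sets_PiM_cong) auto
    then have "Measurable.pred (PiM {1..} N) (S n) \<longleftrightarrow> Measurable.pred (\<Pi>\<^sub>M k\<in>{1..}. \<nu>) (S n)" for n
      by (intro arg_cong[where f="\<lambda>X. S n \<in> X"] measurable_cong_sets) auto
    then show "Measurable.pred (PiM {1..} N) (S n)" for n
      using that(3) ctl_measurable by (auto simp: full_def)
    show "S i (\<xi>(m := x)) = S i \<xi>" if "i \<le> m" for i m \<xi> x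
      using \<open>S = full \<or> S = ctl\<close> by (elim disjE) (simp_all add: full_def ctl_def decusum_control_past[OF that])
  qed (fact that(1) that(2) lm assms(7))+
  have obs_const: "observations \<nu> (\<lambda>_. F) S l \<Theta>" if "F = F0 \<or> F \<in> Fd ` \<Theta>" "S = full \<or> S = ctl" for F S
    using that pF0 pFd by (intro obs) (auto simp: F0_def Fd_def)
  have obs_change: "observations \<nu> (\<lambda>n. density \<nu> (\<lambda>x. ennreal (if n < \<gamma> then f0 x else f \<theta> x))) S l \<Theta>"
    if "\<theta> \<in> \<Theta>" "S = full \<or> S = ctl" for \<theta> \<gamma> S
  proof (intro obs)
    show "prob_space (density \<nu> (\<lambda>x. ennreal (if i < \<gamma> then f0 x else f \<theta> x)))" for i
      using pF0 pFd[OF that(1)] by (cases "i < \<gamma>") (simp_all add: F0_def Fd_def)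
  qed (use that in auto)
  have sub: "subalgebra (P_change \<nu> f0 (f \<theta>) \<gamma>) (info \<nu> S n)" if "S = full \<or> S = ctl" for \<theta> \<gamma> n S
    using that ctl_measurable by (intro subalgebra_info) (auto simp: full_def)

  \<comment> \<open>Expected stopping times of both procedures\<close>
  define stop where "stop S = first_passage (glr f0 f \<Theta> S)" for S
  have stop: "enat n < stop S a \<xi> \<longleftrightarrow> below S l \<Theta> a n \<xi>" if "0 < a" for n S a \<xi>
    unfolding stop_def less_first_passage_glr_iff[OF assms(7) ne that] by (simp add: l_def[abs_def])
  have GC: "control (GCuSum f0 f \<Theta> a) = full" "stop_time (GCuSum f0 f \<Theta> a) = stop full a" for a
    by (simp_all add: GCuSum_def full_def stop_def)
  have GD: "control (GDECuSum f0 f \<Theta> \<theta>s \<mu> h a) = ctl" "stop_time (GDECuSum f0 f \<Theta> \<theta>s \<mu> h a) = stop ctl a" for a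
    by (simp_all add: GDECuSum_def ctl_def stop_def)
  define E where "E F S a = (\<integral>\<^sup>+\<xi>. ennreal_of_enat (stop S a \<xi>) \<partial>PiM {1..} (\<lambda>_. F))" for F S a
  have E: "E F S a = (\<Sum>n. \<integral>\<^sup>+\<xi>. of_bool (below S l \<Theta> a n \<xi>) \<partial>PiM {1..} (\<lambda>_. F))"
    if "F = F0 \<or> F \<in> Fd ` \<Theta>" "S = full \<or> S = ctl" "0 < a" for F S a
    unfolding E_def by (rule observations.expected_stopping_time[OF obs_const[OF that(1,2)] stop[OF that(3)]])
  have E_mono: "E F full a \<le> E F ctl a" if F: "F = F0 \<or> F \<in> Fd ` \<Theta>" and "0 < a" for F a
    using skipping_delays_stopping[OF obs_const[OF F, of ctl] obs_const[OF F, of full, unfolded full_def] \<open>0 < a\<close>]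
    by (simp add: E[OF F _ \<open>0 < a\<close>] full_def)

  \<comment> \<open>\<open>ln\<close> and division have conventional values at 0, so
    \<open>exp\<close> of \<open>l\<close> is the density ratio only where the densities are
    positive. Two parameters are compared through \<open>f0\<close>, as both laws are equivalent to
    the pre-change law.\<close>
  have AE_fd: "AE x in Fd \<theta>. 0 < f0 x \<and> 0 < f \<theta> x \<and> 0 < f \<theta>' x" if "\<theta> \<in> \<Theta>" "\<theta>' \<in> \<Theta>" for \<theta> \<theta>'
  proof -
    have ac: "absolutely_continuous F0 (Fd \<theta>)" "absolutely_continuous (Fd \<theta>') F0"
      using KL1[OF that(1)] KL0[OF that(2)] by (simp_all add: KL_finite_def F0_def Fd_def)
    then have ac': "absolutely_continuous (Fd \<theta>') (Fd \<theta>)"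
      unfolding absolutely_continuous_def by blast
    have "AE x in Fd \<theta>. 0 < f0 x" "AE x in Fd \<theta>. 0 < f \<theta>' x" "AE x in Fd \<theta>. 0 < f \<theta> x"
      using ac ac' f f0 that unfolding Fd_def F0_def
      by (auto intro: AE_density_pos_of_absolutely_continuous AE_density_pos_self)
    then show ?thesis by eventually_elim simp
  qed
  have AE_f0: "AE x in F0. 0 < f0 x \<and> 0 < f \<theta> x" if "\<theta> \<in> \<Theta>" for \<theta>
  proof -
    have "absolutely_continuous (Fd \<theta>) F0" using KL0[OF that] by (simp add: KL_finite_def F0_def Fd_def)
    then have "AE x in F0. 0 < f0 x" "AE x in F0. 0 < f \<theta> x"
      using f f0 that unfolding Fd_def F0_def
      by (auto intro: AE_density_pos_of_absolutely_continuous AE_density_pos_self)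
    then show ?thesis by eventually_elim simp
  qed

  \<comment> \<open>False alarm rate and observation cost\<close>
  have part1: "FAR \<nu> f0 (GDECuSum f0 f \<Theta> \<theta>s \<mu> h (A \<alpha>)) \<le> FAR \<nu> f0 (GCuSum f0 f \<Theta> (A \<alpha>))
      \<and> FAR \<nu> f0 (GCuSum f0 f \<Theta> (A \<alpha>)) \<le> ennreal \<alpha>
      \<and> PDC \<nu> f0 (GDECuSum f0 f \<Theta> \<theta>s \<mu> h (A \<alpha>)) = PDC \<nu> f0 (DECuSum f0 (f \<theta>s) \<mu> h (A \<alpha>))"
    if \<alpha>: "0 < \<alpha>" "\<alpha> < 1" for \<alpha>
  proof (intro conjI)
    note a = A_pos[OF \<alpha>]
    have FAR: "FAR \<nu> f0 (GDECuSum f0 f \<Theta> \<theta>s \<mu> h (A \<alpha>)) = inverse (E F0 ctl (A \<alpha>))"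
      "FAR \<nu> f0 (GCuSum f0 f \<Theta> (A \<alpha>)) = inverse (E F0 full (A \<alpha>))"
      by (simp_all add: FAR_def GC GD E_def P_inf_def F0_def divide_ennreal_def)
    show "FAR \<nu> f0 (GDECuSum f0 f \<Theta> \<theta>s \<mu> h (A \<alpha>)) \<le> FAR \<nu> f0 (GCuSum f0 f \<Theta> (A \<alpha>))"
      unfolding FAR by (intro ennreal_inverse_antimono E_mono a) simp
    have "ennreal (exp (A \<alpha>)) \<le> of_nat (card \<Theta>) * E F0 full (A \<alpha>)"
      unfolding E[OF disjI1[OF refl] disjI1[OF refl] a]
    proof (rule observations.exp_level_le[OF obs_const])
      show "(\<integral>\<^sup>+x. ennreal (exp (l \<theta> x)) \<partial>F0) \<le> 1" if "\<theta> \<in> \<Theta>" for \<theta>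
        unfolding F0_def
      proof (rule nn_integral_likelihood_ratio_le_1[OF f0 f[OF that]])
        show "AE x in density \<nu> (\<lambda>x. ennreal (f0 x)). exp (l \<theta> x) = f \<theta> x / f0 x"
          using AE_f0[OF that] unfolding F0_def by eventually_elim (simp add: l_def)
      qed
    qed (use ne in \<open>auto simp: full_def\<close>)
    moreover have "exp (A \<alpha>) = M / \<alpha>" using \<alpha> M by (simp add: A_def M_def)
    moreover have "(of_nat (card \<Theta>) :: ennreal) = ennreal M" by (simp add: M_def ennreal_of_nat_eq_real_of_nat)
    ultimately have le: "ennreal (M / \<alpha>) \<le> ennreal M * E F0 full (A \<alpha>)" by simp
    \<comment> \<open>An infinite expected time gives rate 0; otherwise the factor \<open>M\<close>
      cancels and the expected time is at least 1 / \<alpha>.\<close>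
    show "FAR \<nu> f0 (GCuSum f0 f \<Theta> (A \<alpha>)) \<le> ennreal \<alpha>"
    proof (cases "E F0 full (A \<alpha>)")
      case (real e)
      have "ennreal (M / \<alpha>) \<le> ennreal (M * e)" using le real M by (simp add: ennreal_mult)
      then have "M / \<alpha> \<le> M * e" by (subst (asm) ennreal_le_iff) (use real M in auto)
      then have "1 / \<alpha> \<le> e" using mult_le_cancel_left_pos[of M "1 / \<alpha>" e] M by simp
      moreover from this have "0 < e" by (rule less_le_trans[rotated]) (use \<alpha> in simp)
      ultimately have "0 < e" "1 / e \<le> \<alpha>" using \<alpha> by (auto simp: field_simps)
      then show ?thesis unfolding FAR real(2) by (simp add: inverse_ennreal inverse_eq_divide ennreal_leI)
    qed (simp add: FAR)
    \<comment> \<open>The cost involves only the control, which the two procedures share and which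
      runs on after stopping.\<close>
    show "PDC \<nu> f0 (GDECuSum f0 f \<Theta> \<theta>s \<mu> h (A \<alpha>)) = PDC \<nu> f0 (DECuSum f0 (f \<theta>s) \<mu> h (A \<alpha>))"
      by (simp add: PDC_def GDECuSum_def DECuSum_def)
  qed

  \<comment> \<open>Delay asymptotics, for both procedures at once\<close>
  have part2: "(\<lambda>\<alpha>. enn2real (W (A \<alpha>))) \<sim>[at_right 0] (\<lambda>\<alpha>. \<bar>ln \<alpha>\<bar> / KL \<nu> (f \<theta>) f0)"
    if \<theta>: "\<theta> \<in> \<Theta>" and h_fin: "h < \<infinity>"
      and W: "W = (\<lambda>a. WADD \<nu> f0 (f \<theta>) (GCuSum f0 f \<Theta> a)) \<and> S = full
        \<or> W = (\<lambda>a. WADD \<nu> f0 (f \<theta>) (GDECuSum f0 f \<Theta> \<theta>s \<mu> h a)) \<and> S = ctl" for \<theta> W S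
  proof -
    obtain \<Psi> where WP: "W = (\<lambda>a. WADD \<nu> f0 (f \<theta>) (\<Psi> a))" and \<Psi>: "\<And>a. control (\<Psi> a) = S" "\<And>a. stop_time (\<Psi> a) = stop S a"
      and S: "S = full \<or> S = ctl"
      using W GC GD by (elim disjE conjE) blast+
    define D where "D = KL \<nu> (f \<theta>) f0"
    have D: "0 < D" "integrable (Fd \<theta>) (l \<theta>)" "(\<integral>x. l \<theta> x \<partial>Fd \<theta>) = D"
      using KL_pos_imp_integrable[OF \<nu> f[OF \<theta>] f0] KL1[OF \<theta>] by (auto simp: D_def Fd_def l_def[abs_def])
    have inF: "Fd \<theta> = F0 \<or> Fd \<theta> \<in> Fd ` \<Theta>" using \<theta> by blast
    have P1: "P_change \<nu> f0 (f \<theta>) 1 = PiM {1..} (\<lambda>_. Fd \<theta>)"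
      unfolding P_change_def Fd_def by (intro PiM_cong) auto
    have setsP: "sets (P_change \<nu> f0 (f \<theta>) \<gamma>) = sets (\<Pi>\<^sub>M k\<in>{1..}. \<nu>)" for \<gamma>
      unfolding P_change_def by (intro sets_PiM_cong) auto
    have "(\<lambda>\<alpha>. enn2real (W (ln (M / \<alpha>)))) \<sim>[at_right 0] (\<lambda>\<alpha>. \<bar>ln \<alpha>\<bar> / D)"
    proof (rule delay_asymptotics[OF D(1)])
      show "0 < M" using M by simp
      fix c a :: real assume c: "1 \<le> c" and a: "0 < a"
      have "ennreal a \<le> ennreal (ln c) + ennreal ((\<integral>x. l \<theta> x \<partial>Fd \<theta>) + card \<Theta> / c) * E (Fd \<theta>) full a"
        unfolding E[OF inF disjI1[OF refl] a]
      proof (rule observations.level_le[OF obs_const[OF inF] _ _ \<theta> D(2)])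
        show "(\<integral>\<^sup>+x. ennreal (exp (- l \<theta> x)) \<partial>Fd \<theta>) \<le> 1"
          unfolding Fd_def
        proof (rule nn_integral_likelihood_ratio_le_1[OF f[OF \<theta>] f0])
          show "AE x in density \<nu> (\<lambda>x. ennreal (f \<theta> x)). exp (- l \<theta> x) = f0 x / f \<theta> x"
            using AE_fd[OF \<theta> \<theta>] unfolding Fd_def by eventually_elim (simp add: l_def exp_minus)
        qed
        show "(\<integral>\<^sup>+x. ennreal (exp (l \<theta>' x - l \<theta> x)) \<partial>Fd \<theta>) \<le> 1" if "\<theta>' \<in> \<Theta>" for \<theta>'
          unfolding Fd_def
        proof (rule nn_integral_likelihood_ratio_le_1[OF f[OF \<theta>] f[OF that]])
          show "AE x in density \<nu> (\<lambda>x. ennreal (f \<theta> x)). exp (l \<theta>' x - l \<theta> x) = f \<theta>' x / f \<theta> x"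
            using AE_fd[OF \<theta> that] unfolding Fd_def by eventually_elim (simp add: l_def exp_diff)
        qed
      qed (use D c in \<open>auto simp: full_def\<close>)
      \<comment> \<open>With the change at time 1 all samples are i.i.d., so the skipping procedure
        inherits the lower bound of the fully observed one.\<close>
      also have "E (Fd \<theta>) full a \<le> E (Fd \<theta>) S a"
        using S E_mono[OF inF a] by auto
      also have "E (Fd \<theta>) S a \<le> 1 + W a"
      proof -
        interpret observations \<nu> "\<lambda>_. Fd \<theta>" S l \<Theta> by (rule obs_const[OF inF S])
        show ?thesis
          using expected_stop_time_le_WADD[of \<nu> f0 "f \<theta>" "\<Psi> a"] P.prob_space_axioms sub[OF S, of \<theta> 1 0] measurable_below'
          by (simp add: P1 \<Psi> WP stop[OF a] E_def)
      qed
      finally show "ennreal a \<le> ennreal (ln c) + ennreal (D + M / c) * (1 + W a)"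
        by (simp add: D M_def add_left_mono mult_left_mono)
    next
      fix m assume m: "0 < m" "m < D"
      obtain c where c: "0 \<le> c" "integrable (Fd \<theta>) (\<lambda>x. min (l \<theta> x) c)" "m \<le> (\<integral>x. min (l \<theta> x) c \<partial>Fd \<theta>)"
        using exists_truncation[OF D(2)] m D(3) by metis
      \<comment> \<open>The potential that pays for skips: 0 under full observation, otherwise a
        function of the current state of the observation control.\<close>
      obtain Q :: "nat \<Rightarrow> (nat \<Rightarrow> 'a) \<Rightarrow> ennreal" and K where K: "0 \<le> K"
        and Q: "\<And>n. Q n \<in> borel_measurable (\<Pi>\<^sub>M k\<in>{1..}. \<nu>)" "\<And>n \<xi>. Q n \<xi> \<le> ennreal K"
          "\<And>n \<xi>. S (Suc n) \<xi> \<Longrightarrow> (\<integral>\<^sup>+x. Q (Suc n) (\<xi>(Suc n := x)) \<partial>Fd \<theta>) \<le> Q n \<xi>"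
          "\<And>n \<xi> x. \<not> S (Suc n) \<xi> \<Longrightarrow> 1 + Q (Suc n) (\<xi>(Suc n := x)) \<le> Q n \<xi>"
      proof (cases "S = full")
        case True
        then show thesis by (intro that[of 0 "\<lambda>_ _. 0"]) (auto simp: full_def)
      next
        case False
        then have S: "S = ctl" using S by blast
        obtain h' where h': "h = ereal h'" "0 \<le> h'" using h h_fin by (cases h) auto
        interpret observations \<nu> "\<lambda>_. Fd \<theta>" ctl l \<Theta> by (intro obs_const[OF inF]) simp
        have X1: "(\<lambda>\<xi>. \<xi> 1) \<in> P \<rightarrow>\<^sub>M Fd \<theta>" by (intro measurable_component_singleton) auto
        have "distr P (Fd \<theta>) (\<lambda>\<xi>. \<xi> 1) = Fd \<theta>"
          using pFd[OF \<theta>] by (intro distr_PiM_component) auto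
        then have "(\<integral>\<xi>. l \<theta>s (\<xi> 1) \<partial>P) = (\<integral>x. l \<theta>s x \<partial>Fd \<theta>)"
          using integral_distr[OF X1, of "l \<theta>s"] lm[OF \<theta>s] by (simp add: Fd_def)
        \<comment> \<open>Here the drift condition acts: under every post-change law the statistic
          of \<open>\<theta>s\<close> has upward drift while it is being observed.\<close>
        then have pos: "0 < (\<integral>x. l \<theta>s x \<partial>Fd \<theta>)"
          using drift[OF \<theta>] unfolding P1 by (simp add: l_def)
        then have int: "integrable (Fd \<theta>) (l \<theta>s)"
          using not_integrable_integral_eq by (metis less_irrefl)
        obtain \<phi> K where \<phi>: "\<phi> \<in> borel_measurable borel"
            "\<And>w. - h' \<le> w \<Longrightarrow> \<phi> w \<le> ennreal K"
            "\<And>w. 0 \<le> w \<Longrightarrow> (\<integral>\<^sup>+x. \<phi> (max (- h') (w + l \<theta>s x)) \<partial>Fd \<theta>) \<le> \<phi> w"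
            "\<And>w. w < 0 \<Longrightarrow> 1 + \<phi> (min 0 (w + \<mu>)) \<le> \<phi> w"
          using skip_potential[OF pFd[OF \<theta>] int pos \<mu> h'(2)] by metis
        define w where "w = decusum_real (l \<theta>s) \<mu> h'"
        \<comment> \<open>The decision on sample n + 1 reads the statistic at time n, so it is fixed
          before that sample is redrawn.\<close>
        have ctl_iff: "ctl (Suc n) \<xi> \<longleftrightarrow> 0 \<le> w n \<xi>" for n \<xi>
          unfolding ctl_def decusum_control_def h' decusum_eq_decusum_real w_def by (simp add: l_def[abs_def])
        show thesis
        \<comment> \<open>The sign of \<open>K\<close> is unspecified at this point, hence the
          maximum with 0.\<close>
        proof (rule that[of "max 0 K" "\<lambda>n \<xi>. \<phi> (w n \<xi>)"])
          show "(\<lambda>\<xi>. \<phi> (w n \<xi>)) \<in> borel_measurable (\<Pi>\<^sub>M k\<in>{1..}. \<nu>)" for n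
            unfolding w_def using \<phi>(1) lm[OF \<theta>s]
            by (intro measurable_compose[OF measurable_decusum_real]) auto
          show "\<phi> (w n \<xi>) \<le> ennreal (max 0 K)" for n \<xi>
            using \<phi>(2)[of "w n \<xi>"] decusum_real_ge[OF h'(2), of \<mu> "l \<theta>s" n \<xi>] \<mu>
            by (auto simp: w_def ennreal_max_0 max.commute)
          show "(\<integral>\<^sup>+x. \<phi> (w (Suc n) (\<xi>(Suc n := x))) \<partial>Fd \<theta>) \<le> \<phi> (w n \<xi>)" if "S (Suc n) \<xi>" for n \<xi>
            using that \<phi>(3)[of "w n \<xi>"] unfolding S ctl_iff by (simp add: w_def decusum_real_past)
          show "1 + \<phi> (w (Suc n) (\<xi>(Suc n := x))) \<le> \<phi> (w n \<xi>)" if "\<not> S (Suc n) \<xi>" for n \<xi> x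
            using that \<phi>(4)[of "w n \<xi>"] unfolding S ctl_iff by (simp add: w_def decusum_real_past)
        qed simp
      qed
      have "W a \<le> ennreal ((a + c) / m) + ennreal K" if a: "0 < a" for a
        unfolding WP
      proof (rule WADD_le[where F="Fd \<theta>" and Q=Q and l=l and \<Theta>=\<Theta>, OF _ _ \<theta> a c(1,2) m(1) c(3)], unfold \<Psi>)
        show "Q n \<in> borel_measurable (P_change \<nu> f0 (f \<theta>) \<gamma>)" for n \<gamma>
          using Q(1) measurable_cong_sets[OF setsP refl] by blast
      qed (use Q obs_change[OF \<theta> S] sub[OF S] stop[OF a] in \<open>auto simp: Fd_def\<close>)
      then show "\<exists>b\<ge>0. \<exists>K\<ge>0. \<forall>a>0. W a \<le> ennreal ((a + b) / m) + ennreal K"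
        using c K by blast
    qed
    then show ?thesis by (simp add: A_def M_def D_def)
  qed
  have asymp: "(\<lambda>\<alpha>. enn2real (WADD \<nu> f0 (f \<theta>) (GCuSum f0 f \<Theta> (A \<alpha>)))) \<sim>[at_right 0] (\<lambda>\<alpha>. \<bar>ln \<alpha>\<bar> / KL \<nu> (f \<theta>) f0)"
    "(\<lambda>\<alpha>. enn2real (WADD \<nu> f0 (f \<theta>) (GDECuSum f0 f \<Theta> \<theta>s \<mu> h (A \<alpha>)))) \<sim>[at_right 0] (\<lambda>\<alpha>. \<bar>ln \<alpha>\<bar> / KL \<nu> (f \<theta>) f0)"
    if "\<theta> \<in> \<Theta>" "h < \<infinity>" for \<theta>
    using part2[OF that, of "\<lambda>a. WADD \<nu> f0 (f \<theta>) (GCuSum f0 f \<Theta> a)" full]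
      part2[OF that, of "\<lambda>a. WADD \<nu> f0 (f \<theta>) (GDECuSum f0 f \<Theta> \<theta>s \<mu> h a)" ctl] by blast+
  have "(\<lambda>\<alpha>. enn2real (WADD \<nu> f0 (f \<theta>) (GDECuSum f0 f \<Theta> \<theta>s \<mu> h (A \<alpha>)))) \<sim>[at_right 0]
      (\<lambda>\<alpha>. enn2real (WADD \<nu> f0 (f \<theta>) (GCuSum f0 f \<Theta> (A \<alpha>))))"
    if "\<theta> \<in> \<Theta>" "h < \<infinity>" for \<theta>
    using asymp_equiv_trans[OF asymp(2)[OF that] asymp_equiv_symI[OF asymp(1)[OF that]]] .
  with part1 asymp(1) show ?thesis by blast
qed

end
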